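(* Let $f\in L^2(0,T;V^\star)$, $y_0\in H$, and for $v,w\in W(0,T)$ let $$b(v,w):=\int_0^T (v_t,w_t)_{V^\star}+\int_0^T(v,w)_V+(v(T),w(T))_H,\qquad l(w):=(y_0,w(0))_H+\int_0^T(f,w_t)_{V^\star}+\int_0^T\langle f,w\rangle_{V^\star,V}.$$ Let $y\in W(0,T)$ be the unique solution of $b(y,w)=l(w)$ for all $w\in W(0,T)$, and let $W_d\subset W(0,T)$ be a finite-dimensional subspace. Then the problem of finding $y_d\in W_d$ with $$b(y_d,w_d)=l(w_d)\qquad\forall w_d\in W_d$$ admits a unique solution $y_d\in W_d$. Moreover, $$\|y-y_d\|_{W(0,T)}\le (1+C_e^2)\inf_{w_d\in W_d}\|y-w_d\|_{W(0,T)},$$ where $C_e$ denotes the constant of the continuous embedding $W(0,T)\hookrightarrow C([0,T],H)$.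
   Context: $V$ and $H$ are real separable Hilbert spaces with $V\hookrightarrow H\equiv H^\star\hookrightarrow V^\star$ forming a Gelfand triple (continuous dense embeddings). $a:V\times V\to\mathbb{R}$ is a symmetric, continuous, coercive bilinear form, and $V$ is equipped with the inner product $(u,v)_V:=a(u,v)$. $A:V\to V^\star$ is the Riesz isomorphism $\langle Au,v\rangle_{V^\star,V}:=a(u,v)$, and $R:=A^{-1}:V^\star\to V$ is the Riesz lift. $V^\star$ carries the inner product $(\phi,\psi)_{V^\star}:=(R\phi,R\psi)_V$. For $T>0$, $W(0,T):=\{v\in L^2(0,T;V)\mid v_t\in L^2(0,T;V^\star)\}$ with inner product $(u,v)_{W(0,T)}:=\int_0^T(u_t,v_t)_{V^\star}+\int_0^T(u,v)_V$ and induced norm. Point values $v(0),v(T)\in H$ are understood via the continuous embedding $W(0,T)\hookrightarrow C([0,T],H)$; $C_e$ is a constant with $\|v\|_{C([0,T],H)}\le C_e\|v\|_{W(0,T)}$ for all $v\in W(0,T)$. The continuous problem $b(y,w)=l(w)$ for all $w\in W(0,T)$ has a unique solution (Lax--Milgram). *)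

theory Defs
  imports "HOL-Analysis.Analysis"
begin

section \<open>Coercive forms and the dual of a separable Hilbert space\<close>

definition coercive_form :: "('v::real_normed_vector \<Rightarrow> 'v \<Rightarrow> real) \<Rightarrow> bool" where
  "coercive_form a \<longleftrightarrow> bounded_bilinear a \<and> (\<forall>u v. a u v = a v u) \<and>
     (\<exists>\<alpha>>0. \<forall>u. a u u \<ge> \<alpha> * (norm u)\<^sup>2)"

lemma coercive_form_inner: "coercive_form (inner :: 'v::real_inner \<Rightarrow> 'v \<Rightarrow> real)"
  unfolding coercive_form_def
  using bounded_bilinear_inner by (auto simp: inner_commute power2_norm_eq_inner intro!: exI[of _ 1])

lemma coercive_form_represents:
  fixes a :: "'v::banach \<Rightarrow> 'v \<Rightarrow> real"
  assumes "coercive_form a" and \<phi>: "bounded_linear \<phi>"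
  shows "\<exists>u. \<forall>v. a u v = \<phi> v"
proof -
  from assms obtain \<alpha> where bb: "bounded_bilinear a" and sym: "\<And>u v. a u v = a v u"
    and \<alpha>: "\<alpha> > 0" "\<And>u. a u u \<ge> \<alpha> * (norm u)\<^sup>2"
    unfolding coercive_form_def by blast
  interpret bounded_bilinear a by fact
  interpret F: bounded_linear \<phi> by fact
  obtain K where K: "\<And>x. \<bar>\<phi> x\<bar> \<le> norm x * K" using F.bounded by auto
  define J where "J u = a u u / 2 - \<phi> u" for u
  have lower: "J u \<ge> - K\<^sup>2 / (2 * \<alpha>)" for u
  proof -
    have "0 \<le> (\<alpha> * norm u - K)\<^sup>2" by simp
    hence "- K\<^sup>2 \<le> (2 * \<alpha>) * (\<alpha> * (norm u)\<^sup>2 / 2 - norm u * K)"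
      by (simp add: power2_eq_square algebra_simps)
    hence "- K\<^sup>2 / (2 * \<alpha>) \<le> \<alpha> * (norm u)\<^sup>2 / 2 - norm u * K"
      using \<alpha>(1) by (subst pos_divide_le_eq) (simp_all add: mult.commute mult.left_commute)
    with \<alpha>(2)[of u] K[of u] show ?thesis unfolding J_def by (simp add: abs_le_iff)
  qed
  define m where "m = Inf (range J)"
  have bdd: "bdd_below (range J)" using lower by (auto intro!: bdd_belowI)
  have m_le: "m \<le> J u" for u unfolding m_def by (rule cInf_lower) (use bdd in auto)
  have "\<exists>u. J u < m + 1 / real (Suc n)" for n
  proof -
    have "Inf (range J) < m + 1 / real (Suc n)" by (simp add: m_def)
    thus ?thesis using cInf_less_iff[of "range J"] bdd by auto
  qed
  then obtain U where U: "\<And>n. J (U n) < m + 1 / real (Suc n)" by metis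
  have par: "J u + J w - 2 * J ((1/2) *\<^sub>R (u + w)) = a (u - w) (u - w) / 4" for u w
    unfolding J_def
    by (simp add: scaleR_left scaleR_right add_left add_right diff_left diff_right
        F.add F.scaleR sym[of w u] field_simps)
  have close: "\<alpha> * (norm (U i - U j))\<^sup>2 \<le> 4 * (1 / real (Suc i) + 1 / real (Suc j))" for i j
    using par[of "U i" "U j"] U[of i] U[of j] m_le[of "(1/2) *\<^sub>R (U i + U j)"] \<alpha>(2)[of "U i - U j"]
    by (simp add: algebra_simps)
  have "Cauchy U"
  proof (rule metric_CauchyI)
    fix e :: real assume e: "e > 0"
    obtain N where N: "real (Suc N) > 8 / (\<alpha> * e\<^sup>2)"
      by (meson less_Suc_eq reals_Archimedean2 of_nat_less_iff less_trans)
    have "dist (U i) (U j) < e" if "i \<ge> N" "j \<ge> N" for i j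
    proof -
      have "\<alpha> * (norm (U i - U j))\<^sup>2 \<le> 4 * (1 / real (Suc N) + 1 / real (Suc N))"
        by (rule order_trans[OF close]) (use that in \<open>intro mult_left_mono add_mono divide_left_mono; simp\<close>)
      also have "\<dots> < \<alpha> * e\<^sup>2" using N \<alpha>(1) e by (simp add: field_simps)
      finally have "(norm (U i - U j))\<^sup>2 < e\<^sup>2" using \<alpha>(1) by simp
      thus ?thesis using e by (simp add: dist_norm power2_less_imp_less)
    qed
    thus "\<exists>M. \<forall>i\<ge>M. \<forall>j\<ge>M. dist (U i) (U j) < e" by blast
  qed
  then obtain u where lim: "U \<longlonglongrightarrow> u" using Cauchy_convergent convergent_def by blast
  have "(\<lambda>n. J (U n)) \<longlonglongrightarrow> J u" unfolding J_def
    by (intro tendsto_intros tendsto F.tendsto lim) simp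
  moreover have "(\<lambda>n. m + 1 / real (Suc n)) \<longlonglongrightarrow> m + 0"
    by (intro tendsto_intros LIMSEQ_Suc[OF lim_1_over_n])
  ultimately have "J u \<le> m + 0"
    by (rule LIMSEQ_le) (use U less_imp_le in blast)
  hence min: "J u \<le> J w" for w using m_le[of w] by simp
  have "a u v = \<phi> v" for v
  proof (rule ccontr)
    assume ne: "a u v \<noteq> \<phi> v"
    define d where "d = a u v - \<phi> v"
    define q where "q = a v v"
    have q0: "q \<ge> 0"
      unfolding q_def using \<alpha>(2)[of v] \<alpha>(1) by (meson order_trans mult_nonneg_nonneg zero_le_power2 less_imp_le)
    define t where "t = - d / (q + 1)"
    have "J (u + t *\<^sub>R v) = J u + t * d + t\<^sup>2 * q / 2"
      unfolding J_def d_def q_def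
      by (simp add: scaleR_left scaleR_right add_left add_right F.add F.scaleR sym[of v u]
          power2_eq_square field_simps)
    with min[of "u + t *\<^sub>R v"] have "0 \<le> t * d + t\<^sup>2 * q / 2" by simp
    moreover have d: "d = - t * (q + 1)" and "t \<noteq> 0"
      using q0 ne by (auto simp: t_def d_def)
    ultimately have "t\<^sup>2 * (q / 2 + 1) \<le> 0"
      unfolding d by (simp add: algebra_simps power2_eq_square)
    moreover have "t\<^sup>2 * (q / 2 + 1) > 0"
      using q0 \<open>t \<noteq> 0\<close> by (intro mult_pos_pos) auto
    ultimately show False by simp
  qed
  thus ?thesis by blast
qed

text \<open>The library's Bochner integral is available only for types of class
  \<open>second_countable_topology\<close>. The following instance makes it available for functions with values
  in the dual of a separable Hilbert space.\<close>

lemma countable_dense_imp_countable_basis: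
  fixes D :: "'a::metric_space set"
  assumes "countable D" and dense: "\<And>x e. e > 0 \<Longrightarrow> \<exists>d\<in>D. dist d x < e"
  shows "\<exists>B::'a set set. countable B \<and> topological_basis B"
proof (intro exI conjI)
  let ?B = "(\<lambda>(d, r). ball d (real_of_rat r)) ` (D \<times> UNIV)"
  show "countable ?B" using assms(1) by (intro countable_image countable_SIGMA) auto
  show "topological_basis ?B"
  proof (rule topological_basisI)
    fix O' :: "'a set" and x assume "open O'" "x \<in> O'"
    then obtain e where e: "e > 0" "ball x e \<subseteq> O'" by (meson openE)
    from dense[of "e/4" x] e(1) obtain d where d: "d \<in> D" "dist d x < e/4" by auto
    obtain r where r: "e/4 < real_of_rat r" "real_of_rat r < e/2"
      using of_rat_dense[of "e/4" "e/2"] e(1) by auto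
    have "ball d (real_of_rat r) \<subseteq> O'"
    proof
      fix z assume "z \<in> ball d (real_of_rat r)"
      hence "dist x z < e" using d(2) r dist_triangle[of x z d] by (simp add: dist_commute)
      thus "z \<in> O'" using e(2) by auto
    qed
    moreover have "x \<in> ball d (real_of_rat r)" using d r by simp
    ultimately show "\<exists>B'\<in>?B. x \<in> B' \<and> B' \<subseteq> O'" using d(1) by force
  qed auto
qed

instance blinfun :: ("{real_inner, banach, second_countable_topology}", euclidean_space)
  second_countable_topology
proof
  obtain D :: "'a set" where D: "countable D" "\<And>X. open X \<Longrightarrow> X \<noteq> {} \<Longrightarrow> \<exists>d\<in>D. d \<in> X"
    using countable_dense_exists by blast
  define \<Psi> :: "('b \<Rightarrow> 'a) \<Rightarrow> 'a \<Rightarrow>\<^sub>L 'b"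
    where "\<Psi> d = (\<Sum>b\<in>Basis. blinfun_scaleR_left b o\<^sub>L blinfun_inner_right (d b))" for d
  have app: "\<Psi> d x = (\<Sum>b\<in>Basis. inner (d b) x *\<^sub>R b)" for d x
    by (simp add: \<Psi>_def blinfun.sum_left)
  let ?D = "\<Psi> ` (PiE (Basis :: 'b set) (\<lambda>_. D))"
  have "\<exists>B::('a \<Rightarrow>\<^sub>L 'b) set set. countable B \<and> topological_basis B"
  proof (rule countable_dense_imp_countable_basis[of ?D])
    show "countable ?D" using D(1) by (intro countable_image countable_PiE) auto
    fix F :: "'a \<Rightarrow>\<^sub>L 'b" and e :: real assume e: "e > 0"
    have "\<exists>u. \<forall>v. inner u v = inner (F v) b" for b
      by (rule coercive_form_represents[OF coercive_form_inner]) (auto intro!: bounded_linear_intros)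
    then obtain u where u: "\<And>b v. inner (u b) v = inner (F v) b" by metis
    define \<epsilon> where "\<epsilon> = e / (2 * real DIM('b))"
    have \<epsilon>: "\<epsilon> > 0" using e by (simp add: \<epsilon>_def)
    have "\<exists>d\<in>D. dist (u b) d < \<epsilon>" for b
      using D(2)[of "ball (u b) \<epsilon>"] \<epsilon> by auto
    then obtain d0 where d0: "\<And>b. d0 b \<in> D" "\<And>b. dist (u b) (d0 b) < \<epsilon>" by metis
    define d where "d = restrict d0 (Basis :: 'b set)"
    have "norm (\<Psi> d - F) \<le> real DIM('b) * \<epsilon>"
    proof (rule norm_blinfun_bound)
      show "0 \<le> real DIM('b) * \<epsilon>" using \<epsilon> by simp
      fix x
      have "(\<Psi> d - F) x = (\<Sum>b\<in>Basis. inner (d b) x *\<^sub>R b) - (\<Sum>b\<in>Basis. inner (F x) b *\<^sub>R b)"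
        by (simp add: blinfun.diff_left app euclidean_representation)
      also have "\<dots> = (\<Sum>b\<in>Basis. inner (d b - u b) x *\<^sub>R b)"
        by (simp add: sum_subtractf inner_diff_left u scaleR_left_diff_distrib)
      also have "norm \<dots> \<le> (\<Sum>b\<in>(Basis :: 'b set). \<epsilon> * norm x)"
      proof (rule sum_norm_le)
        fix b :: 'b assume b: "b \<in> Basis"
        have "\<bar>inner (d b - u b) x\<bar> \<le> norm (d b - u b) * norm x" by (rule Cauchy_Schwarz_ineq2)
        also have "\<dots> \<le> \<epsilon> * norm x"
          using d0(2)[of b] b by (intro mult_right_mono) (auto simp: d_def dist_norm norm_minus_commute)
        finally show "norm (inner (d b - u b) x *\<^sub>R b) \<le> \<epsilon> * norm x" using b by simp
      qed
      finally show "norm ((\<Psi> d - F) x) \<le> real DIM('b) * \<epsilon> * norm x" by simp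
    qed
    also have "\<dots> < e" using e by (simp add: \<epsilon>_def)
    finally have "dist (\<Psi> d) F < e" by (simp add: dist_norm)
    moreover have "\<Psi> d \<in> ?D" using d0(1) by (auto simp: d_def)
    ultimately show "\<exists>G\<in>?D. dist G F < e" by blast
  qed
  then obtain B :: "('a \<Rightarrow>\<^sub>L 'b) set set" where "countable B" "topological_basis B" by blast
  thus "\<exists>B::('a \<Rightarrow>\<^sub>L 'b) set set. countable B \<and> open = generate_topology B"
    using topological_basis_imp_subbasis by blast
qed


section \<open>Gelfand triple\<close>

text \<open>\<open>\<iota>\<close> is the embedding of \<open>V\<close> into \<open>H\<close>. Its adjoint \<open>dual_embed \<iota>\<close>, the embedding of
  \<open>H\<close> into \<open>V\<^sup>*\<close>, is then automatically continuous, injective and of dense range.\<close>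

definition gelfand_embedding :: "('v::real_normed_vector \<Rightarrow> 'h::real_normed_vector) \<Rightarrow> bool" where
  "gelfand_embedding \<iota> \<longleftrightarrow> bounded_linear \<iota> \<and> inj \<iota> \<and> closure (range \<iota>) = UNIV"

definition dual_embed :: "('v::real_normed_vector \<Rightarrow> 'h::real_inner) \<Rightarrow> 'h \<Rightarrow> 'v \<Rightarrow>\<^sub>L real" where
  "dual_embed \<iota> h = Blinfun (\<lambda>v. inner h (\<iota> v))"

definition riesz_op :: "('v::real_normed_vector \<Rightarrow> 'v \<Rightarrow> real) \<Rightarrow> 'v \<Rightarrow> 'v \<Rightarrow>\<^sub>L real" where
  "riesz_op a u = Blinfun (\<lambda>v. a u v)"

definition riesz_lift :: "('v::real_normed_vector \<Rightarrow> 'v \<Rightarrow> real) \<Rightarrow> ('v \<Rightarrow>\<^sub>L real) \<Rightarrow> 'v" where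
  "riesz_lift a = inv (riesz_op a)"

definition dual_inner ::
  "('v::real_normed_vector \<Rightarrow> 'v \<Rightarrow> real) \<Rightarrow> ('v \<Rightarrow>\<^sub>L real) \<Rightarrow> ('v \<Rightarrow>\<^sub>L real) \<Rightarrow> real" where
  "dual_inner a \<phi> \<psi> = a (riesz_lift a \<phi>) (riesz_lift a \<psi>)"


section \<open>Bochner spaces on the time interval\<close>

text \<open>Elements of \<open>L\<^sup>2(0,T;X)\<close> and of its subspaces are represented by functions on the reals;
  two functions represent the same element iff they agree almost everywhere on \<open>(0,T)\<close>.
  On \<open>V\<close> and its dual the norm of the type is used for square integrability; it is equivalent
  to the one induced by \<open>a\<close>.\<close>

abbreviation time :: "real \<Rightarrow> real measure" where
  "time T \<equiv> lebesgue_on {0<..<T}"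

definition ae_eq :: "real \<Rightarrow> (real \<Rightarrow> 'b) \<Rightarrow> (real \<Rightarrow> 'b) \<Rightarrow> bool" where
  "ae_eq T u v \<longleftrightarrow> (AE t in time T. u t = v t)"

definition L2 :: "real \<Rightarrow> (real \<Rightarrow> 'b::{banach, second_countable_topology}) set" where
  "L2 T = {u \<in> borel_measurable (time T). integrable (time T) (\<lambda>t. (norm (u t))\<^sup>2)}"

definition test_functions :: "real \<Rightarrow> (real \<Rightarrow> real) set" where
  "test_functions T = {\<eta>. (\<forall>k t. ((deriv ^^ k) \<eta>) differentiable (at t)) \<and>
     (\<exists>K. compact K \<and> K \<subseteq> {0<..<T} \<and> (\<forall>t. t \<notin> K \<longrightarrow> \<eta> t = 0))}"

text \<open>Distributional derivative in \<open>V\<^sup>*\<close>, where \<open>v\<close> is regarded as a \<open>V\<^sup>*\<close>-valued function.\<close>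

definition has_weak_derivative ::
  "('v::{real_inner, banach, second_countable_topology} \<Rightarrow> 'h::real_inner) \<Rightarrow> real \<Rightarrow>
   (real \<Rightarrow> 'v) \<Rightarrow> (real \<Rightarrow> 'v \<Rightarrow>\<^sub>L real) \<Rightarrow> bool" where
  "has_weak_derivative \<iota> T v g \<longleftrightarrow> (\<forall>\<eta>\<in>test_functions T.
     (\<integral>t. deriv \<eta> t *\<^sub>R dual_embed \<iota> (\<iota> (v t)) \<partial>time T) = - (\<integral>t. \<eta> t *\<^sub>R g t \<partial>time T))"

definition W ::
  "('v::{real_inner, banach, second_countable_topology} \<Rightarrow> 'h::real_inner) \<Rightarrow> real \<Rightarrow>
   (real \<Rightarrow> 'v) set" where
  "W \<iota> T = {v \<in> L2 T. \<exists>g\<in>L2 T. has_weak_derivative \<iota> T v g}"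

definition weak_deriv ::
  "('v::{real_inner, banach, second_countable_topology} \<Rightarrow> 'h::real_inner) \<Rightarrow> real \<Rightarrow>
   (real \<Rightarrow> 'v) \<Rightarrow> real \<Rightarrow> 'v \<Rightarrow>\<^sub>L real" where
  "weak_deriv \<iota> T v = (SOME g. g \<in> L2 T \<and> has_weak_derivative \<iota> T v g)"

definition W_inner ::
  "('v::{real_inner, banach, second_countable_topology} \<Rightarrow> 'h::real_inner) \<Rightarrow>
   ('v \<Rightarrow> 'v \<Rightarrow> real) \<Rightarrow> real \<Rightarrow> (real \<Rightarrow> 'v) \<Rightarrow> (real \<Rightarrow> 'v) \<Rightarrow> real" where
  "W_inner \<iota> a T u v =
     (\<integral>t. dual_inner a (weak_deriv \<iota> T u t) (weak_deriv \<iota> T v t) \<partial>time T) +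
     (\<integral>t. a (u t) (v t) \<partial>time T)"

definition W_norm ::
  "('v::{real_inner, banach, second_countable_topology} \<Rightarrow> 'h::real_inner) \<Rightarrow>
   ('v \<Rightarrow> 'v \<Rightarrow> real) \<Rightarrow> real \<Rightarrow> (real \<Rightarrow> 'v) \<Rightarrow> real" where
  "W_norm \<iota> a T v = sqrt (W_inner \<iota> a T v v)"

text \<open>A finite-dimensional linear subspace of \<open>W(0,T)\<close>: linearly closed as a set of functions,
  and of finite dimension after identifying functions that agree almost everywhere.\<close>

definition finite_dim_subspace ::
  "('v::{real_inner, banach, second_countable_topology} \<Rightarrow> 'h::real_inner) \<Rightarrow> real \<Rightarrow>
   (real \<Rightarrow> 'v) set \<Rightarrow> bool" where
  "finite_dim_subspace \<iota> T S \<longleftrightarrow> S \<subseteq> W \<iota> T \<and> (\<lambda>t. 0) \<in> S \<and>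
     (\<forall>u\<in>S. \<forall>v\<in>S. (\<lambda>t. u t + v t) \<in> S) \<and> (\<forall>c. \<forall>u\<in>S. (\<lambda>t. c *\<^sub>R u t) \<in> S) \<and>
     (\<exists>B. finite B \<and> B \<subseteq> S \<and> (\<forall>v\<in>S. \<exists>c. ae_eq T v (\<lambda>t. \<Sum>b\<in>B. c b *\<^sub>R b t)))"


section \<open>Point values\<close>

definition is_continuous_rep ::
  "('v \<Rightarrow> 'h::real_inner) \<Rightarrow> real \<Rightarrow> (real \<Rightarrow> 'v) \<Rightarrow> (real \<Rightarrow> 'h) \<Rightarrow> bool" where
  "is_continuous_rep \<iota> T v u \<longleftrightarrow> continuous_on {0..T} u \<and> ae_eq T u (\<lambda>t. \<iota> (v t))"

text \<open>For \<open>t\<close> in \<open>[0,T]\<close>, \<open>pt \<iota> T v t\<close> is the value at \<open>t\<close> of the image of \<open>v\<close> in \<open>C([0,T],H)\<close>;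
  two continuous representatives agree on all of \<open>[0,T]\<close>.\<close>

definition pt :: "('v \<Rightarrow> 'h::real_inner) \<Rightarrow> real \<Rightarrow> (real \<Rightarrow> 'v) \<Rightarrow> real \<Rightarrow> 'h" where
  "pt \<iota> T v = (SOME u. is_continuous_rep \<iota> T v u)"

definition embedding_constant ::
  "('v::{real_inner, banach, second_countable_topology} \<Rightarrow> 'h::real_inner) \<Rightarrow>
   ('v \<Rightarrow> 'v \<Rightarrow> real) \<Rightarrow> real \<Rightarrow> real \<Rightarrow> bool" where
  "embedding_constant \<iota> a T C \<longleftrightarrow> (\<forall>v\<in>W \<iota> T. is_continuous_rep \<iota> T v (pt \<iota> T v) \<and>
     (SUP t\<in>{0..T}. norm (pt \<iota> T v t)) \<le> C * W_norm \<iota> a T v)"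


section \<open>The variational problem\<close>

definition b_form ::
  "('v::{real_inner, banach, second_countable_topology} \<Rightarrow> 'h::real_inner) \<Rightarrow>
   ('v \<Rightarrow> 'v \<Rightarrow> real) \<Rightarrow> real \<Rightarrow> (real \<Rightarrow> 'v) \<Rightarrow> (real \<Rightarrow> 'v) \<Rightarrow> real" where
  "b_form \<iota> a T v w =
     (\<integral>t. dual_inner a (weak_deriv \<iota> T v t) (weak_deriv \<iota> T w t) \<partial>time T) +
     (\<integral>t. a (v t) (w t) \<partial>time T) +
     inner (pt \<iota> T v T) (pt \<iota> T w T)"

definition l_form ::
  "('v::{real_inner, banach, second_countable_topology} \<Rightarrow> 'h::real_inner) \<Rightarrow>
   ('v \<Rightarrow> 'v \<Rightarrow> real) \<Rightarrow> real \<Rightarrow> (real \<Rightarrow> 'v \<Rightarrow>\<^sub>L real) \<Rightarrow> 'h \<Rightarrow> (real \<Rightarrow> 'v) \<Rightarrow> real" where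
  "l_form \<iota> a T f y\<^sub>0 w =
     inner y\<^sub>0 (pt \<iota> T w 0) +
     (\<integral>t. dual_inner a (f t) (weak_deriv \<iota> T w t) \<partial>time T) +
     (\<integral>t. blinfun_apply (f t) (w t) \<partial>time T)"

end

theory Submission
  imports Defs "HOL-Real_Asymp.Real_Asymp"
begin

text \<open>The form \<open>b\<close> is symmetric and satisfies
  \<open>\<parallel>v\<parallel>\<^sup>2 \<le> b(v, v)\<close> and \<open>b(v, w) \<le> (1 + C\<^sub>e\<^sup>2) \<parallel>v\<parallel> \<parallel>w\<parallel>\<close> for the norm of
  \<open>W(0,T)\<close>: the terminal term is nonnegative on the diagonal and is bounded through the embedding
  into \<open>C([0,T],H)\<close>. Coercivity makes the finite-dimensional problem uniquely solvable, and
  Galerkin orthogonality \<open>b(y - y\<^sub>d, w\<^sub>d) = 0\<close> gives the quasi-optimality estimate (Cea's lemma).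
  The delicate point is that \<open>weak_deriv\<close> is a choice among representatives: it depends linearly on
  the function, up to null sets, only because weak derivatives are almost everywhere unique, which
  is the fundamental lemma of the calculus of variations.\<close>

section \<open>Smooth bump functions and uniqueness of weak derivatives\<close>

text \<open>The classical flat function at 0. The exponent \<open>i\<close> is carried along because
  differentiating \<open>exp (- (1 / x))\<close> brings out further powers of \<open>1 / x\<close>:
  the linear combinations of the whole family, not of a single member, are stable under
  differentiation.\<close>

definition exp_germ :: "nat \<Rightarrow> real \<Rightarrow> real" where
  "exp_germ i x = (if x > 0 then (1 / x) ^ i * exp (- (1 / x)) else 0)"

lemma tendsto_exp_germ_0: "(exp_germ i \<longlongrightarrow> 0) (at 0)"
proof -
  have "((\<lambda>x::real. (1 / x) ^ i * exp (- (1 / x))) \<longlongrightarrow> 0) (at_right 0)"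
    by real_asymp
  hence "(exp_germ i \<longlongrightarrow> 0) (at_right 0)"
    by (rule Lim_transform_eventually)
      (auto simp: exp_germ_def eventually_at_right_field intro!: exI[of _ 1])
  moreover have "(exp_germ i \<longlongrightarrow> 0) (at_left 0)"
    by (rule Lim_transform_eventually[OF tendsto_const])
      (auto simp: exp_germ_def eventually_at_left_field intro!: exI[of _ "-1"])
  ultimately show ?thesis by (simp add: filterlim_split_at)
qed

lemma DERIV_exp_germ:
  "(exp_germ i has_real_derivative exp_germ (i + 2) x - real i * exp_germ (i + 1) x) (at x)"
proof -
  consider "x > 0" | "x < 0" | "x = 0" by linarith
  thus ?thesis
  proof cases
    case 1
    have "((\<lambda>x. (1 / x) ^ i) has_real_derivative real i * (- 1 / x\<^sup>2) * (1 / x) ^ (i - 1)) (at x)"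
      using 1 by (auto intro!: derivative_eq_intros simp: power2_eq_square)
    also have "real i * (- 1 / x\<^sup>2) * (1 / x) ^ (i - 1) = - real i * (1 / x) ^ (i + 1)"
      using 1 by (cases i) (auto simp: field_simps power2_eq_square)
    finally have pow: "((\<lambda>x. (1 / x) ^ i) has_real_derivative - real i * (1 / x) ^ (i + 1)) (at x)" .
    have "((\<lambda>x. exp (- (1 / x))) has_real_derivative exp (- (1 / x)) * (1 / x)\<^sup>2) (at x)"
      using 1 by (auto intro!: derivative_eq_intros simp: power2_eq_square)
    from DERIV_mult[OF pow this] have "((\<lambda>x. (1 / x) ^ i * exp (- (1 / x))) has_real_derivative
        exp_germ (i + 2) x - real i * exp_germ (i + 1) x) (at x)"
      by (rule DERIV_cong) (use 1 in \<open>simp add: exp_germ_def power_add power2_eq_square mult_ac\<close>)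
    thus ?thesis
      by (rule has_field_derivative_transform_within_open[of _ _ _ "{0<..}"])
        (use 1 in \<open>auto simp: exp_germ_def\<close>)
  next
    case 2
    have "((\<lambda>x. 0) has_real_derivative 0) (at x)" by simp
    hence "(exp_germ i has_real_derivative 0) (at x)"
      by (rule has_field_derivative_transform_within_open[of _ _ _ "{..<0}"])
        (use 2 in \<open>auto simp: exp_germ_def\<close>)
    thus ?thesis using 2 by (simp add: exp_germ_def)
  next
    case 3
    \<comment> \<open>Since \<open>exp_germ i 0\<close> is 0 and dividing
      \<open>exp_germ i h\<close> by \<open>h\<close> raises the power by one, the difference
      quotient at 0 is \<open>exp_germ (Suc i) h\<close>.\<close>
    have "((\<lambda>h. (exp_germ i (0 + h) - exp_germ i 0) / h) \<longlongrightarrow> 0) (at 0)"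
      by (rule Lim_transform_eventually[OF tendsto_exp_germ_0[of "Suc i"]])
        (auto simp: exp_germ_def eventually_at_filter)
    thus ?thesis using 3 by (simp add: DERIV_def exp_germ_def)
  qed
qed

text \<open>A class of functions closed under differentiation, hence consisting of smooth functions.\<close>

inductive bump_algebra :: "(real \<Rightarrow> real) \<Rightarrow> bool" where
  const: "bump_algebra (\<lambda>x. c)"
| germ: "bump_algebra (\<lambda>x. exp_germ i (\<alpha> * x + \<beta>))"
| add: "bump_algebra f \<Longrightarrow> bump_algebra g \<Longrightarrow> bump_algebra (\<lambda>x. f x + g x)"
| mult: "bump_algebra f \<Longrightarrow> bump_algebra g \<Longrightarrow> bump_algebra (\<lambda>x. f x * g x)"

lemma bump_algebra_DERIV:
  "bump_algebra f \<Longrightarrow> \<exists>g. bump_algebra g \<and> (\<forall>x. (f has_real_derivative g x) (at x))"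
proof (induction rule: bump_algebra.induct)
  case (const c)
  show ?case by (rule exI[of _ "\<lambda>x. 0"]) (auto intro: bump_algebra.intros)
next
  case (germ i \<alpha> \<beta>)
  \<comment> \<open>The subtraction in \<open>DERIV_exp_germ\<close> becomes the addition of a
    product with the constant \<open>- real i\<close>, which matches the introduction rules of the
    class.\<close>
  let ?g = "\<lambda>x. \<alpha> * (exp_germ (i + 2) (\<alpha> * x + \<beta>) + (- real i) * exp_germ (i + 1) (\<alpha> * x + \<beta>))"
  have "bump_algebra ?g" by (intro bump_algebra.intros)
  moreover have "((\<lambda>x. exp_germ i (\<alpha> * x + \<beta>)) has_real_derivative ?g x) (at x)" for x
    by (rule DERIV_chain2[where f = "exp_germ i" and g = "\<lambda>x. \<alpha> * x + \<beta>",
            OF DERIV_exp_germ, THEN DERIV_cong])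
      (auto intro!: derivative_eq_intros simp: algebra_simps)
  ultimately show ?case by blast
next
  case (add f g)
  then obtain f' g' where *: "bump_algebra f'" "\<And>x. (f has_real_derivative f' x) (at x)"
    "bump_algebra g'" "\<And>x. (g has_real_derivative g' x) (at x)" by blast
  show ?case
    by (rule exI[of _ "\<lambda>x. f' x + g' x"]) (use * in \<open>auto intro!: bump_algebra.add DERIV_add\<close>)
next
  case (mult f g)
  then obtain f' g' where *: "bump_algebra f'" "\<And>x. (f has_real_derivative f' x) (at x)"
    "bump_algebra g'" "\<And>x. (g has_real_derivative g' x) (at x)" by blast
  show ?case
    by (rule exI[of _ "\<lambda>x. f' x * g x + g' x * f x"])
      (use * mult in \<open>auto intro!: bump_algebra.intros DERIV_mult\<close>)
qed

lemma bump_algebra_differentiable: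
  assumes "bump_algebra f"
  shows "((deriv ^^ k) f) differentiable (at t)"
proof -
  have "bump_algebra ((deriv ^^ k) f)"
  proof (induction k)
    case (Suc k)
    then obtain g where "bump_algebra g" "\<And>x. ((deriv ^^ k) f has_real_derivative g x) (at x)"
      using bump_algebra_DERIV by blast
    hence "deriv ((deriv ^^ k) f) = g" by (intro ext DERIV_imp_deriv)
    thus ?case using \<open>bump_algebra g\<close> by simp
  qed (simp add: assms)
  thus ?thesis using bump_algebra_DERIV real_differentiable_def by blast
qed

text \<open>Smooth approximation of the indicator of the open interval (c, d): it vanishes outside,
  and the factor \<open>real (Suc n)\<close> lets it rise to 1 inside as \<open>n\<close> grows. The
  arguments are spelled as \<alpha> x + \<beta> to match the rule \<open>germ\<close>.\<close>

definition bump :: "real \<Rightarrow> real \<Rightarrow> nat \<Rightarrow> real \<Rightarrow> real" where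
  "bump c d n x = exp_germ 0 (real (Suc n) * x + (- real (Suc n) * c)) *
     exp_germ 0 (- real (Suc n) * x + real (Suc n) * d)"

lemma bump_algebra_bump: "bump_algebra (bump c d n)"
  unfolding bump_def by (intro bump_algebra.intros)

lemma bump_eq:
  "bump c d n x = (if c < x \<and> x < d
     then exp (- (1 / (real (Suc n) * (x - c)))) * exp (- (1 / (real (Suc n) * (d - x)))) else 0)"
proof -
  have "real (Suc n) * x + (- real (Suc n) * c) = real (Suc n) * (x - c)"
    "- real (Suc n) * x + real (Suc n) * d = real (Suc n) * (d - x)"
    by (simp_all add: algebra_simps)
  thus ?thesis unfolding bump_def exp_germ_def by (simp add: zero_less_mult_iff del: of_nat_Suc)
qed

lemma bump_bounds: "0 \<le> bump c d n x" "bump c d n x \<le> 1"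
  unfolding bump_eq by (auto intro!: mult_le_one)

lemma bump_tendsto: "(\<lambda>n. bump c d n x) \<longlonglongrightarrow> indicator {c<..<d} x"
proof (cases "c < x \<and> x < d")
  case True
  have *: "(\<lambda>n. 1 / (real (Suc n) * r)) \<longlonglongrightarrow> 0" if "r > 0" for r
    using that by real_asymp
  have "(\<lambda>n. exp (- (1 / (real (Suc n) * (x - c)))) * exp (- (1 / (real (Suc n) * (d - x))))) \<longlonglongrightarrow> exp (- 0) * exp (- 0)"
    using True by (intro tendsto_intros *) auto
  thus ?thesis using True by (simp add: bump_eq del: of_nat_Suc)
qed (auto simp: bump_eq)

lemma bump_test_function:
  assumes "0 < c" "d < T"
  shows "bump c d n \<in> test_functions T"
proof -
  have "compact {c..d}" "{c..d} \<subseteq> {0<..<T}" "\<forall>t. t \<notin> {c..d} \<longrightarrow> bump c d n t = 0"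
    using assms by (auto simp: bump_eq)
  thus ?thesis
    unfolding test_functions_def using bump_algebra_differentiable[OF bump_algebra_bump] by blast
qed

text \<open>The fundamental lemma of the calculus of variations. Bumps converge boundedly to
  indicators, so dominated convergence with majorant \<open>\<bar>h t\<bar>\<close> makes the
  integral of \<open>h\<close> vanish over every interval with 0 < c and d < T. Lebesgue
  differentiation then forces \<open>h\<close> to vanish almost everywhere.\<close>

lemma integral_test_functions_eq_0_imp_AE:
  fixes h :: "real \<Rightarrow> real"
  assumes h: "integrable (time T) h"
    and zero: "\<And>\<eta>. \<eta> \<in> test_functions T \<Longrightarrow> (\<integral>t. \<eta> t * h t \<partial>time T) = 0"
  shows "AE t in time T. h t = 0"
proof -
  \<comment> \<open>Extension by zero, so that the differentiation theorem for gauge integrals over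
    the whole line applies.\<close>
  define h' where "h' t = indicator {0<..<T} t *\<^sub>R h t" for t
  have open_int: "(\<integral>t. indicator {c<..<d} t * h t \<partial>time T) = 0" if "0 < c" "d < T" for c d
  proof -
    have [measurable]: "bump c d n \<in> borel_measurable (time T)" for n
    proof (rule continuous_imp_measurable_on_sets_lebesgue)
      have "bump c d n differentiable (at t)" for t
        using bump_algebra_differentiable[OF bump_algebra_bump, of 0] by simp
      thus "continuous_on {0<..<T} (bump c d n)"
        by (intro continuous_at_imp_continuous_on ballI differentiable_imp_continuous_within)
    qed simp
    have [measurable]: "h \<in> borel_measurable (time T)" using h by simp
    have "(\<lambda>n. \<integral>t. bump c d n t * h t \<partial>time T) \<longlonglongrightarrow> (\<integral>t. indicator {c<..<d} t * h t \<partial>time T)"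
    proof (rule integral_dominated_convergence[where w = "\<lambda>t. \<bar>h t\<bar>"])
      show "(\<lambda>t. indicator {c<..<d} t * h t) \<in> borel_measurable (time T)"
        by (intro borel_measurable_times) (auto intro!: borel_measurable_indicator' measurable_restrict_space1)
      show "AE t in time T. norm (bump c d n t * h t) \<le> \<bar>h t\<bar>" for n
        using bump_bounds[of c d n] by (intro AE_I2) (simp add: abs_mult mult_left_le_one_le)
    qed (use h in \<open>auto intro!: tendsto_mult bump_tendsto\<close>)
    moreover have "(\<integral>t. bump c d n t * h t \<partial>time T) = 0" for n
      by (rule zero[OF bump_test_function[OF that]])
    ultimately show ?thesis using LIMSEQ_unique[OF tendsto_const] by fastforce
  qed
  have h': "integrable lebesgue h'"
    using h unfolding h'_def by (subst (asm) integrable_restrict_space) auto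
  have h'0: "integral {c..d} h' = 0" if cd: "0 < c" "d < T" for c d
  proof -
    have "integral {c..d} h' = integral {c<..<d} h'" by (simp add: integral_open_interval_real)
    also have "\<dots> = (\<integral>t. h' t \<partial>lebesgue_on {c<..<d})"
      using integrable_mult_indicator[OF _ h', of "{c<..<d}"]
      by (intro lebesgue_integral_eq_integral[symmetric]) (auto simp: integrable_restrict_space)
    also have "\<dots> = (\<integral>t. indicator {c<..<d} t * h t \<partial>time T)"
      using cd by (auto simp: integral_restrict_space h'_def indicator_def intro!: Bochner_Integration.integral_cong)
    finally show ?thesis using open_int[OF cd] by simp
  qed
  have "h' integrable_on cbox a b" for a b
    using integrable_on_lebesgue[OF h'] integrable_on_subcbox by blast
  \<comment> \<open>Lebesgue differentiation in one-sided form: outside a negligible set the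
    averages over [x, x + s] tend to the value at x.\<close>
  then obtain N where N: "negligible N"
    "\<And>x e. \<lbrakk>x \<notin> N; 0 < e\<rbrakk> \<Longrightarrow> \<exists>d>0. \<forall>s. 0 < s \<and> s < d \<longrightarrow>
        norm (integral (cbox x (x + s *\<^sub>R One)) h' /\<^sub>R s ^ DIM(real) - h' x) < e"
    using integrable_ccontinuous_explicit by blast
  have "h t = 0" if t: "t \<in> {0<..<T}" "t \<notin> N" for t
  proof (rule ccontr)
    assume "h t \<noteq> 0"
    then obtain d where d: "d > 0" "\<And>s. 0 < s \<Longrightarrow> s < d \<Longrightarrow>
        norm (integral {t..t + s} h' /\<^sub>R s - h' t) < \<bar>h t\<bar>"
      using N(2)[OF t(2), of "\<bar>h t\<bar>"] by auto
    \<comment> \<open>Small enough for the differentiation estimate and for t + s to stay below T.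
      The average over [t, t + s] is then 0, and the estimate becomes
      \<open>\<bar>h t\<bar> < \<bar>h t\<bar>\<close>.\<close>
    define s where "s = min (d / 2) ((T - t) / 2)"
    have "0 < s" "s < d" "t + s < T" using d(1) t by (auto simp: s_def min_def field_simps)
    thus False using d(2)[of s] h'0[of t "t + s"] t by (simp add: h'_def)
  qed
  moreover have "AE t in lebesgue. t \<notin> N"
    using N(1) by (simp add: negligible_iff_null_sets AE_not_in)
  ultimately show ?thesis by (subst AE_restrict_space_iff) auto
qed

section \<open>Linear and bilinear operations on square-integrable functions\<close>

lemma L2_measurable [measurable_dest]: "u \<in> L2 T \<Longrightarrow> u \<in> borel_measurable (time T)"
  by (simp add: L2_def)

lemma L2_integrable: "u \<in> L2 T \<Longrightarrow> integrable (time T) (\<lambda>t. (norm (u t))\<^sup>2)"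
  by (simp add: L2_def)

text \<open>The single operation u + c v covers sums, multiples and, with c = -1, differences; the
  later linearity lemmas all have this shape. Integrability rests on (x + y)^2 \<le> 2 x^2 + 2
  y^2.\<close>

lemma L2_add_scaleR:
  assumes "u \<in> L2 T" "v \<in> L2 T"
  shows "(\<lambda>t. u t + c *\<^sub>R v t) \<in> L2 T"
proof -
  note [measurable] = L2_measurable[OF assms(1)] L2_measurable[OF assms(2)]
  have "(norm (u t + c *\<^sub>R v t))\<^sup>2 \<le> 2 * (norm (u t))\<^sup>2 + 2 * c\<^sup>2 * (norm (v t))\<^sup>2" for t
  proof -
    have "(norm (u t + c *\<^sub>R v t))\<^sup>2 \<le> (norm (u t) + \<bar>c\<bar> * norm (v t))\<^sup>2"
      by (intro power_mono) (auto intro: norm_triangle_le)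
    also have "\<dots> \<le> 2 * (norm (u t))\<^sup>2 + 2 * (\<bar>c\<bar> * norm (v t))\<^sup>2"
      using sum_squares_bound[of "norm (u t)" "\<bar>c\<bar> * norm (v t)"] by (simp add: power2_sum)
    finally show ?thesis by (simp add: power_mult_distrib)
  qed
  moreover have "integrable (time T) (\<lambda>t. 2 * (norm (u t))\<^sup>2 + 2 * c\<^sup>2 * (norm (v t))\<^sup>2)"
    using assms[THEN L2_integrable] by auto
  ultimately have "integrable (time T) (\<lambda>t. (norm (u t + c *\<^sub>R v t))\<^sup>2)"
    by (intro Bochner_Integration.integrable_bound[where g = "\<lambda>t. (norm (u t + c *\<^sub>R v t))\<^sup>2"]) auto
  thus ?thesis by (simp add: L2_def)
qed

lemma bounded_linear_L2:
  assumes "bounded_linear F" "u \<in> L2 T"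
  shows "(\<lambda>t. F (u t)) \<in> L2 T"
proof -
  interpret F: bounded_linear F by fact
  obtain K where K: "\<And>x. norm (F x) \<le> norm x * K" "K > 0" using F.pos_bounded by blast
  have [measurable]: "F \<in> borel_measurable borel"
    by (intro borel_measurable_continuous_onI linear_continuous_on assms)
  note [measurable] = L2_measurable[OF assms(2)]
  have "(norm (F (u t)))\<^sup>2 \<le> K\<^sup>2 * (norm (u t))\<^sup>2" for t
    using power_mono[OF K(1)[of "u t"], of 2] by (simp add: power_mult_distrib mult.commute)
  moreover have "integrable (time T) (\<lambda>t. K\<^sup>2 * (norm (u t))\<^sup>2)"
    using L2_integrable[OF assms(2)] by simp
  moreover have "(\<lambda>t. (norm (F (u t)))\<^sup>2) \<in> borel_measurable (time T)" by measurable
  ultimately have "integrable (time T) (\<lambda>t. (norm (F (u t)))\<^sup>2)"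
    by (elim Bochner_Integration.integrable_bound) (simp_all add: abs_of_nonneg)
  thus ?thesis by (simp add: L2_def)
qed

text \<open>The crude bound x y \<le> x^2 + y^2 takes the place of the Hoelder inequality. The
  generality in \<open>B\<close> covers scalar multiplication, \<open>a\<close>,
  \<open>dual_inner\<close> and the duality pairing alike.\<close>

lemma integrable_bilinear_L2:
  fixes B :: "'a::{banach, second_countable_topology} \<Rightarrow>
    'b::{banach, second_countable_topology} \<Rightarrow> 'c::{banach, second_countable_topology}"
  assumes "bounded_bilinear B" "u \<in> L2 T" "v \<in> L2 T"
  shows "integrable (time T) (\<lambda>t. B (u t) (v t))"
proof -
  interpret B: bounded_bilinear B by fact
  obtain K where K: "\<And>x y. norm (B x y) \<le> norm x * norm y * K" "K > 0" using B.pos_bounded by blast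
  note [measurable] = L2_measurable[OF assms(2)] L2_measurable[OF assms(3)]
  have [measurable]: "(\<lambda>t. B (u t) (v t)) \<in> borel_measurable (time T)"
    by (rule borel_measurable_continuous_Pair) (auto intro!: B.continuous_on continuous_intros)
  have "norm (B (u t) (v t)) \<le> K * ((norm (u t))\<^sup>2 + (norm (v t))\<^sup>2)" for t
  proof -
    have *: "norm (u t) * norm (v t) \<le> (norm (u t))\<^sup>2 + (norm (v t))\<^sup>2"
      using sum_squares_bound[of "norm (u t)" "norm (v t)"]
        mult_nonneg_nonneg[OF norm_ge_zero[of "u t"] norm_ge_zero[of "v t"]] by linarith
    show ?thesis
      using order_trans[OF K(1)[of "u t" "v t"] mult_right_mono[OF *, of K]] K(2)
      by (simp add: mult.commute)
  qed
  moreover have "integrable (time T) (\<lambda>t. K * ((norm (u t))\<^sup>2 + (norm (v t))\<^sup>2))"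
    using assms(2,3)[THEN L2_integrable] by auto
  moreover have "(\<lambda>t. B (u t) (v t)) \<in> borel_measurable (time T)" by fact
  ultimately show ?thesis
    by (elim Bochner_Integration.integrable_bound) (use K(2) in \<open>simp_all add: abs_of_nonneg\<close>)
qed

lemma continuous_imp_L2:
  assumes "continuous_on {0..T} u"
  shows "u \<in> L2 T"
proof -
  have [measurable]: "u \<in> borel_measurable (time T)"
    by (intro continuous_imp_measurable_on_sets_lebesgue continuous_on_subset[OF assms]) auto
  have "bounded (u ` {0..T})"
    by (intro compact_imp_bounded compact_continuous_image assms) auto
  then obtain M where M: "\<And>t. t \<in> {0..T} \<Longrightarrow> norm (u t) \<le> M"
    unfolding bounded_iff by blast
  have "finite_measure (time T)" by (rule finite_measure_lebesgue_on) simp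
  hence "integrable (time T) (\<lambda>t. (norm (u t))\<^sup>2)"
    using M by (intro finite_measure.integrable_const_bound[where B = "M\<^sup>2"] AE_I2) (auto intro!: power_mono)
  thus ?thesis by (simp add: L2_def)
qed

lemma test_function_L2:
  assumes "\<eta> \<in> test_functions T"
  shows "\<eta> \<in> L2 T" "deriv \<eta> \<in> L2 T"
proof -
  have "((deriv ^^ k) \<eta>) differentiable (at t)" for k t
    using assms by (auto simp: test_functions_def)
  from this[of 0] this[of 1] have "continuous_on {0..T} \<eta>" "continuous_on {0..T} (deriv \<eta>)"
    by (auto intro!: continuous_at_imp_continuous_on differentiable_imp_continuous_within)
  thus "\<eta> \<in> L2 T" "deriv \<eta> \<in> L2 T" by (simp_all add: continuous_imp_L2)
qed

text \<open>The exceptional null set depends on \<open>x\<close>. Separability reduces to countably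
  many \<open>x\<close>, whose null sets can be united, and continuity of \<open>g t\<close> extends
  the vanishing from a dense set to all of V.\<close>

lemma AE_blinfun_eq_0:
  fixes g :: "real \<Rightarrow> 'v::{real_inner, banach, second_countable_topology} \<Rightarrow>\<^sub>L real"
  assumes "\<And>x. AE t in M. blinfun_apply (g t) x = 0"
  shows "AE t in M. g t = 0"
proof -
  obtain D :: "'v set" where D: "countable D" "\<And>X. open X \<Longrightarrow> X \<noteq> {} \<Longrightarrow> \<exists>d\<in>D. d \<in> X"
    using countable_dense_exists by blast
  have dense: "closure D = UNIV"
  proof (intro set_eqI iffI)
    fix x :: 'v
    have "\<exists>d\<in>D. dist d x < e" if "e > 0" for e
      using D(2)[of "ball x e"] that by (auto simp: dist_commute)
    thus "x \<in> closure D" by (simp add: closure_approachable)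
  qed simp
  have "AE t in M. \<forall>d\<in>D. blinfun_apply (g t) d = 0"
    using D(1) assms by (simp add: AE_ball_countable)
  thus ?thesis
  proof eventually_elim
    case (elim t)
    have "closure D \<subseteq> {x. blinfun_apply (g t) x = 0}"
      using elim by (intro closure_minimal closed_Collect_eq continuous_intros) auto
    thus ?case using dense by (intro blinfun_eqI) auto
  qed
qed

text \<open>The difference of two weak derivatives integrates to 0 against every test function.
  Evaluation at a fixed \<open>x\<close> commutes with the Bochner integral, which reduces the claim
  to the scalar fundamental lemma.\<close>

lemma has_weak_derivative_unique:
  assumes g: "g \<in> L2 T" "g' \<in> L2 T"
    and "has_weak_derivative \<iota> T v g" "has_weak_derivative \<iota> T v g'"
  shows "AE t in time T. g t = g' t"
proof -
  define d where "d t = g t + (-1) *\<^sub>R g' t" for t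
  have d: "d \<in> L2 T" unfolding d_def by (intro L2_add_scaleR g)
  have zero: "(\<integral>t. \<eta> t *\<^sub>R d t \<partial>time T) = 0" if \<eta>: "\<eta> \<in> test_functions T" for \<eta>
  proof -
    have "integrable (time T) (\<lambda>t. \<eta> t *\<^sub>R g t)" "integrable (time T) (\<lambda>t. \<eta> t *\<^sub>R g' t)"
      by (intro integrable_bilinear_L2[OF bounded_bilinear_scaleR] test_function_L2[OF \<eta>] g)+
    thus ?thesis
      using assms(3,4) \<eta> by (simp add: d_def has_weak_derivative_def scaleR_right_diff_distrib)
  qed
  have "AE t in time T. blinfun_apply (d t) x = 0" for x
  proof (rule integral_test_functions_eq_0_imp_AE)
    have "(\<lambda>t. blinfun_apply (d t) x) \<in> L2 T"
      by (rule bounded_linear_L2[OF blinfun.bounded_linear_left d])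
    \<comment> \<open>On a bounded interval square integrability gives integrability, by pairing
      with the constant 1.\<close>
    moreover have "(\<lambda>t. 1::real) \<in> L2 T" by (intro continuous_imp_L2 continuous_intros)
    ultimately show "integrable (time T) (\<lambda>t. blinfun_apply (d t) x)"
      using integrable_bilinear_L2[OF bounded_bilinear_mult, of "\<lambda>t. 1" T "\<lambda>t. blinfun_apply (d t) x"]
      by simp
    fix \<eta> assume \<eta>: "\<eta> \<in> test_functions T"
    have "integrable (time T) (\<lambda>t. \<eta> t *\<^sub>R d t)"
      by (intro integrable_bilinear_L2[OF bounded_bilinear_scaleR] test_function_L2[OF \<eta>] d)
    from integral_bounded_linear[OF blinfun.bounded_linear_left this, of x]
    show "(\<integral>t. \<eta> t * blinfun_apply (d t) x \<partial>time T) = 0"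
      using zero[OF \<eta>] by (simp add: blinfun.scaleR_left)
  qed
  from AE_blinfun_eq_0[OF this] show ?thesis by (simp add: d_def)
qed

section \<open>Riesz lift and linearity of the weak derivative\<close>

lemma coercive_form_zero:
  assumes "coercive_form a" "a u u = 0"
  shows "u = 0"
proof -
  obtain \<alpha> where "\<alpha> > 0" "\<alpha> * (norm u)\<^sup>2 \<le> a u u"
    using assms(1) unfolding coercive_form_def by blast
  thus ?thesis using assms(2) by (simp add: mult_le_0_iff)
qed

lemma coercive_form_nonneg:
  assumes "coercive_form a"
  shows "a u u \<ge> 0"
proof -
  obtain \<alpha> where "\<alpha> > 0" "\<alpha> * (norm u)\<^sup>2 \<le> a u u"
    using assms(1) unfolding coercive_form_def by blast
  thus ?thesis by (meson order_trans mult_nonneg_nonneg zero_le_power2 less_imp_le)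
qed

lemma riesz_op_apply: "coercive_form a \<Longrightarrow> blinfun_apply (riesz_op a u) v = a u v"
  unfolding riesz_op_def coercive_form_def
  by (simp add: bounded_linear_Blinfun_apply bounded_bilinear.bounded_linear_right)

text \<open>Since \<open>riesz_lift\<close> is an \<open>inv\<close>, this needs surjectivity of
  \<open>riesz_op a\<close>, which is the representation theorem for coercive forms.\<close>

lemma riesz_lift_apply:
  fixes a :: "'v::banach \<Rightarrow> 'v \<Rightarrow> real"
  assumes "coercive_form a"
  shows "a (riesz_lift a \<phi>) v = blinfun_apply \<phi> v"
proof -
  have "\<phi> \<in> range (riesz_op a)"
  proof -
    obtain u where "\<And>v. a u v = blinfun_apply \<phi> v"
      using coercive_form_represents[OF assms blinfun.bounded_linear_right] by blast
    hence "\<phi> = riesz_op a u" by (intro blinfun_eqI) (simp add: riesz_op_apply assms)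
    thus ?thesis by blast
  qed
  hence "riesz_op a (riesz_lift a \<phi>) = \<phi>" unfolding riesz_lift_def by (rule f_inv_into_f)
  thus ?thesis by (metis riesz_op_apply assms)
qed

lemma coercive_form_eqI:
  assumes "coercive_form a" "\<And>v. a u v = a w v"
  shows "u = w"
proof -
  interpret bounded_bilinear a using assms(1) by (simp add: coercive_form_def)
  have "a (u - w) (u - w) = 0" using assms(2) by (simp add: diff_left)
  thus ?thesis using coercive_form_zero[OF assms(1)] by fastforce
qed

text \<open>Linearity is checked by testing in \<open>a\<close>. With u the lift of \<phi>,
  coercivity gives \<alpha> |u|^2 \<le> a(u, u) = \<phi>(u) \<le> |\<phi>| |u|, hence the bound 1 /
  \<alpha>.\<close>

lemma bounded_linear_riesz_lift:
  fixes a :: "'v::banach \<Rightarrow> 'v \<Rightarrow> real"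
  assumes a: "coercive_form a"
  shows "bounded_linear (riesz_lift a)"
proof -
  interpret bounded_bilinear a using a by (simp add: coercive_form_def)
  obtain \<alpha> where \<alpha>: "\<alpha> > 0" "\<And>u. \<alpha> * (norm u)\<^sup>2 \<le> a u u"
    using a unfolding coercive_form_def by blast
  show ?thesis
  proof (rule bounded_linear_intro[where K = "1 / \<alpha>"])
    fix \<phi> \<psi> c
    show "riesz_lift a (\<phi> + \<psi>) = riesz_lift a \<phi> + riesz_lift a \<psi>"
      by (rule coercive_form_eqI[OF a]) (simp add: riesz_lift_apply[OF a] add_left blinfun.add_left)
    show "riesz_lift a (c *\<^sub>R \<phi>) = c *\<^sub>R riesz_lift a \<phi>"
      by (rule coercive_form_eqI[OF a]) (simp add: riesz_lift_apply[OF a] scaleR_left blinfun.scaleR_left)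
    define u where "u = riesz_lift a \<phi>"
    have "\<alpha> * (norm u)\<^sup>2 \<le> blinfun_apply \<phi> u"
      using \<alpha>(2)[of u] riesz_lift_apply[OF a, of \<phi> u] by (simp add: u_def)
    also have "\<dots> \<le> norm \<phi> * norm u" using norm_blinfun[of \<phi> u] by simp
    finally have "(\<alpha> * norm u) * norm u \<le> norm \<phi> * norm u" by (simp add: power2_eq_square)
    hence "\<alpha> * norm u \<le> norm \<phi>" by (cases "u = 0") auto
    thus "norm (riesz_lift a \<phi>) \<le> norm \<phi> * (1 / \<alpha>)" using \<alpha>(1) by (simp add: u_def field_simps)
  qed
qed

lemma bounded_bilinear_dual_inner:
  fixes a :: "'v::banach \<Rightarrow> 'v \<Rightarrow> real"
  assumes "coercive_form a"
  shows "bounded_bilinear (dual_inner a)"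
proof -
  have "bounded_bilinear a" using assms by (simp add: coercive_form_def)
  from bounded_bilinear.comp[OF this bounded_linear_riesz_lift[OF assms] bounded_linear_riesz_lift[OF assms]]
  show ?thesis by (simp add: dual_inner_def[abs_def])
qed

lemma dual_embed_apply:
  assumes "bounded_linear \<iota>"
  shows "blinfun_apply (dual_embed \<iota> h) v = inner h (\<iota> v)"
  unfolding dual_embed_def
  by (simp add: bounded_linear_Blinfun_apply bounded_linear_inner_right_comp assms)

lemma bounded_linear_dual_embed:
  assumes "bounded_linear \<iota>"
  shows "bounded_linear (\<lambda>v. dual_embed \<iota> (\<iota> v))"
proof -
  obtain K where K: "\<And>x. norm (\<iota> x) \<le> norm x * K" "K > 0"
    using bounded_linear.pos_bounded[OF assms] by blast
  show ?thesis
  proof (rule bounded_linear_intro[where K = "K * K"])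
    fix u v :: 'a and c :: real
    show "dual_embed \<iota> (\<iota> (u + v)) = dual_embed \<iota> (\<iota> u) + dual_embed \<iota> (\<iota> v)"
      by (rule blinfun_eqI) (simp add: dual_embed_apply[OF assms] blinfun.add_left
          linear_add[OF bounded_linear.linear[OF assms]] inner_add_left)
    show "dual_embed \<iota> (\<iota> (c *\<^sub>R u)) = c *\<^sub>R dual_embed \<iota> (\<iota> u)"
      by (rule blinfun_eqI) (simp add: dual_embed_apply[OF assms] blinfun.scaleR_left
          linear_scale[OF bounded_linear.linear[OF assms]])
    show "norm (dual_embed \<iota> (\<iota> u)) \<le> norm u * (K * K)"
    proof (rule norm_blinfun_bound)
      fix x
      have "\<bar>inner (\<iota> u) (\<iota> x)\<bar> \<le> norm (\<iota> u) * norm (\<iota> x)" by (rule Cauchy_Schwarz_ineq2)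
      also have "\<dots> \<le> (norm u * K) * (norm x * K)" using K by (intro mult_mono) auto
      finally show "norm (blinfun_apply (dual_embed \<iota> (\<iota> u)) x) \<le> norm u * (K * K) * norm x"
        by (simp add: dual_embed_apply[OF assms] mult_ac)
    qed (use K in simp)
  qed
qed

lemma has_weak_derivative_add_scaleR:
  assumes \<iota>: "bounded_linear \<iota>"
    and L2: "u \<in> L2 T" "v \<in> L2 T" "g \<in> L2 T" "h \<in> L2 T"
    and "has_weak_derivative \<iota> T u g" "has_weak_derivative \<iota> T v h"
  shows "has_weak_derivative \<iota> T (\<lambda>t. u t + c *\<^sub>R v t) (\<lambda>t. g t + c *\<^sub>R h t)"
  unfolding has_weak_derivative_def
proof
  fix \<eta> assume \<eta>: "\<eta> \<in> test_functions T"
  interpret E: bounded_linear "\<lambda>v. dual_embed \<iota> (\<iota> v)" by (rule bounded_linear_dual_embed[OF \<iota>])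
  let ?E = "\<lambda>v. dual_embed \<iota> (\<iota> v)"
  note int = integrable_bilinear_L2[OF bounded_bilinear_scaleR]
  \<comment> \<open>Integrals may be split only for integrable summands; each of these is a product
    of two square-integrable factors.\<close>
  have i1: "integrable (time T) (\<lambda>t. \<eta> t *\<^sub>R g t)" "integrable (time T) (\<lambda>t. \<eta> t *\<^sub>R h t)"
    by (intro int test_function_L2[OF \<eta>] L2)+
  have i2: "integrable (time T) (\<lambda>t. deriv \<eta> t *\<^sub>R ?E (u t))" "integrable (time T) (\<lambda>t. deriv \<eta> t *\<^sub>R ?E (v t))"
    by (intro int test_function_L2[OF \<eta>] bounded_linear_L2[OF E.bounded_linear_axioms] L2)+
  have "(\<integral>t. deriv \<eta> t *\<^sub>R ?E (u t + c *\<^sub>R v t) \<partial>time T) =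
      (\<integral>t. deriv \<eta> t *\<^sub>R ?E (u t) + c *\<^sub>R (deriv \<eta> t *\<^sub>R ?E (v t)) \<partial>time T)"
    by (simp add: E.add E.scaleR scaleR_right_distrib mult.commute)
  also have "\<dots> = - (\<integral>t. \<eta> t *\<^sub>R g t \<partial>time T) + c *\<^sub>R - (\<integral>t. \<eta> t *\<^sub>R h t \<partial>time T)"
    using i2 assms(6,7) \<eta> by (simp add: has_weak_derivative_def del: scaleR_scaleR)
  also have "\<dots> = - (\<integral>t. \<eta> t *\<^sub>R g t + c *\<^sub>R (\<eta> t *\<^sub>R h t) \<partial>time T)"
    using i1 by (simp del: scaleR_scaleR)
  finally show "(\<integral>t. deriv \<eta> t *\<^sub>R ?E (u t + c *\<^sub>R v t) \<partial>time T) =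
      - (\<integral>t. \<eta> t *\<^sub>R (g t + c *\<^sub>R h t) \<partial>time T)"
    by (simp add: scaleR_right_distrib mult.commute)
qed

section \<open>The chosen weak derivative\<close>

lemma W_L2: "v \<in> W \<iota> T \<Longrightarrow> v \<in> L2 T"
  by (simp add: W_def)

lemma weak_deriv:
  assumes "v \<in> W \<iota> T"
  shows "weak_deriv \<iota> T v \<in> L2 T" "has_weak_derivative \<iota> T v (weak_deriv \<iota> T v)"
proof -
  have "\<exists>g. g \<in> L2 T \<and> has_weak_derivative \<iota> T v g" using assms by (auto simp: W_def)
  from someI_ex[OF this]
  show "weak_deriv \<iota> T v \<in> L2 T" "has_weak_derivative \<iota> T v (weak_deriv \<iota> T v)"
    unfolding weak_deriv_def by auto
qed

text \<open>The choice inside \<open>weak_deriv\<close> is controlled only through this comparison: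
  later identities exhibit a candidate and conclude almost everywhere.\<close>

lemma weak_deriv_eqI:
  assumes "v \<in> W \<iota> T" "g \<in> L2 T" "has_weak_derivative \<iota> T v g"
  shows "AE t in time T. weak_deriv \<iota> T v t = g t"
  by (rule has_weak_derivative_unique[OF weak_deriv(1)[OF assms(1)] assms(2) weak_deriv(2)[OF assms(1)] assms(3)])

lemma W_add_scaleR:
  assumes "bounded_linear \<iota>" "u \<in> W \<iota> T" "v \<in> W \<iota> T"
  shows "(\<lambda>t. u t + c *\<^sub>R v t) \<in> W \<iota> T"
proof -
  let ?g = "\<lambda>t. weak_deriv \<iota> T u t + c *\<^sub>R weak_deriv \<iota> T v t"
  have "?g \<in> L2 T" by (rule L2_add_scaleR[OF assms(2,3)[THEN weak_deriv(1)]])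
  moreover have "has_weak_derivative \<iota> T (\<lambda>t. u t + c *\<^sub>R v t) ?g"
    by (rule has_weak_derivative_add_scaleR[OF assms(1) assms(2,3)[THEN W_L2]
          assms(2,3)[THEN weak_deriv(1)] assms(2,3)[THEN weak_deriv(2)]])
  moreover have "(\<lambda>t. u t + c *\<^sub>R v t) \<in> L2 T" by (rule L2_add_scaleR[OF assms(2,3)[THEN W_L2]])
  ultimately show ?thesis unfolding W_def by blast
qed

lemma weak_deriv_add_scaleR:
  assumes "bounded_linear \<iota>" "u \<in> W \<iota> T" "v \<in> W \<iota> T"
  shows "AE t in time T. weak_deriv \<iota> T (\<lambda>t. u t + c *\<^sub>R v t) t =
    weak_deriv \<iota> T u t + c *\<^sub>R weak_deriv \<iota> T v t"
  by (rule weak_deriv_eqI[OF W_add_scaleR[OF assms] L2_add_scaleR[OF assms(2,3)[THEN weak_deriv(1)]]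
        has_weak_derivative_add_scaleR[OF assms(1) assms(2,3)[THEN W_L2]
          assms(2,3)[THEN weak_deriv(1)] assms(2,3)[THEN weak_deriv(2)]]])

text \<open>The defining identity sees the function only under an integral, so a weak derivative of
  \<open>v\<close> is also one of \<open>u\<close>.\<close>

lemma weak_deriv_cong_AE:
  assumes "bounded_linear \<iota>" "u \<in> W \<iota> T" "v \<in> W \<iota> T" "ae_eq T u v"
  shows "AE t in time T. weak_deriv \<iota> T u t = weak_deriv \<iota> T v t"
proof (rule weak_deriv_eqI[OF assms(2) weak_deriv(1)[OF assms(3)]])
  interpret E: bounded_linear "\<lambda>v. dual_embed \<iota> (\<iota> v)" by (rule bounded_linear_dual_embed[OF assms(1)])
  show "has_weak_derivative \<iota> T u (weak_deriv \<iota> T v)"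
    unfolding has_weak_derivative_def
  proof
    fix \<eta> assume \<eta>: "\<eta> \<in> test_functions T"
    have "(\<integral>t. deriv \<eta> t *\<^sub>R dual_embed \<iota> (\<iota> (u t)) \<partial>time T) =
        (\<integral>t. deriv \<eta> t *\<^sub>R dual_embed \<iota> (\<iota> (v t)) \<partial>time T)"
    proof (rule integral_cong_AE)
      have "(\<lambda>t. dual_embed \<iota> (\<iota> (w t))) \<in> L2 T" if "w \<in> W \<iota> T" for w
        using bounded_linear_L2[OF E.bounded_linear_axioms W_L2[OF that]] .
      thus "(\<lambda>t. deriv \<eta> t *\<^sub>R dual_embed \<iota> (\<iota> (u t))) \<in> borel_measurable (time T)"
        "(\<lambda>t. deriv \<eta> t *\<^sub>R dual_embed \<iota> (\<iota> (v t))) \<in> borel_measurable (time T)"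
        using test_function_L2(2)[OF \<eta>] assms(2,3)
        by (auto intro!: borel_measurable_scaleR L2_measurable)
      show "AE t in time T. deriv \<eta> t *\<^sub>R dual_embed \<iota> (\<iota> (u t)) = deriv \<eta> t *\<^sub>R dual_embed \<iota> (\<iota> (v t))"
        using assms(4) unfolding ae_eq_def by eventually_elim simp
    qed
    thus "(\<integral>t. deriv \<eta> t *\<^sub>R dual_embed \<iota> (\<iota> (u t)) \<partial>time T) = - (\<integral>t. \<eta> t *\<^sub>R weak_deriv \<iota> T v t \<partial>time T)"
      using weak_deriv(2)[OF assms(3)] \<eta> by (simp add: has_weak_derivative_def)
  qed
qed

text \<open>The third function \<open>w\<close> is tied to \<open>u\<close> and \<open>v\<close>
  only almost everywhere, because \<open>weak_deriv\<close> of a combination is the combination of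
  the derivatives only up to a null set.\<close>

lemma integral_bilinear_L2_add_scaleR:
  fixes B :: "'a::{banach, second_countable_topology} \<Rightarrow>
    'b::{banach, second_countable_topology} \<Rightarrow> real"
  assumes B: "bounded_bilinear B"
    and L2: "f \<in> L2 T" "u \<in> L2 T" "v \<in> L2 T" "w \<in> L2 T"
    and ae: "AE t in time T. w t = u t + c *\<^sub>R v t"
  shows "(\<integral>t. B (f t) (w t) \<partial>time T) = (\<integral>t. B (f t) (u t) \<partial>time T) + c * (\<integral>t. B (f t) (v t) \<partial>time T)"
proof -
  interpret bounded_bilinear B by fact
  note int = integrable_bilinear_L2[OF B L2(1)]
  have "(\<integral>t. B (f t) (w t) \<partial>time T) = (\<integral>t. B (f t) (u t) + c * B (f t) (v t) \<partial>time T)"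
  proof (rule integral_cong_AE)
    show "AE t in time T. B (f t) (w t) = B (f t) (u t) + c * B (f t) (v t)"
      using ae by eventually_elim (simp add: add_right scaleR_right)
  qed (use int[OF L2(2)] int[OF L2(3)] int[OF L2(4)] in auto)
  also have "\<dots> = (\<integral>t. B (f t) (u t) \<partial>time T) + c * (\<integral>t. B (f t) (v t) \<partial>time T)"
    using int[OF L2(2)] int[OF L2(3)] by simp
  finally show ?thesis .
qed

lemma integral_bilinear_L2_cong_AE:
  fixes B :: "'a::{banach, second_countable_topology} \<Rightarrow>
    'b::{banach, second_countable_topology} \<Rightarrow> real"
  assumes "bounded_bilinear B" "f \<in> L2 T" "u \<in> L2 T" "w \<in> L2 T" "AE t in time T. w t = u t"
  shows "(\<integral>t. B (f t) (w t) \<partial>time T) = (\<integral>t. B (f t) (u t) \<partial>time T)"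
  \<comment> \<open>The case \<open>c = 0\<close>, where \<open>u\<close> also fills the slot of the
    second summand.\<close>
  using integral_bilinear_L2_add_scaleR[of B f T u u w 0] assms by simp

text \<open>The norm of the difference is continuous and nonnegative with integral 0, so it vanishes
  identically.\<close>

lemma continuous_AE_eq_imp_eq:
  fixes u v :: "real \<Rightarrow> 'h::real_normed_vector"
  assumes "T > 0" "continuous_on {0..T} u" "continuous_on {0..T} v"
    and ae: "AE t in time T. u t = v t" and t: "t \<in> {0..T}"
  shows "u t = v t"
proof -
  define d where "d t = norm (u t - v t)" for t
  have cont: "continuous_on {0..T} d" unfolding d_def by (intro continuous_intros assms)
  have d: "integrable (time T) d"
    using integrable_bilinear_L2[OF bounded_bilinear_mult continuous_imp_L2[OF cont], of "\<lambda>t. 1"]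
    by (simp add: continuous_imp_L2)
  have "(d has_integral (integral\<^sup>L (time T) d)) {0<..<T}"
    by (rule has_integral_integral_lebesgue_on[OF d]) simp
  moreover have "integral\<^sup>L (time T) d = 0"
  proof (rule integral_eq_zero_AE)
    show "AE t in time T. d t = 0" using ae by eventually_elim (simp add: d_def)
  qed
  \<comment> \<open>Adding the end points leaves the integral unchanged and brings 0 and T, where
    \<open>l\<close> and \<open>b\<close> take point values, into the conclusion.\<close>
  ultimately have "(d has_integral 0) (cbox 0 T)"
    using has_integral_open_interval[of d 0 0 T] by simp
  hence "d t = 0"
    using assms(1) cont t
    by (intro has_integral_0_cbox_imp_0[where a = 0 and b = T and f = d]) (auto simp: d_def)
  thus ?thesis by (simp add: d_def)
qed

section \<open>The variational forms\<close>

text \<open>The algebraic core of Cauchy-Schwarz, including the degenerate case D = 0, where the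
  polynomial is affine and its slope must vanish.\<close>

lemma nonneg_quadratic_discriminant:
  fixes A B D :: real
  assumes "0 \<le> D" "\<And>s. 0 \<le> A + 2 * s * B + s\<^sup>2 * D"
  shows "B\<^sup>2 \<le> A * D"
proof (cases "D = 0")
  case True
  have "B = 0"
  proof (rule ccontr)
    assume "B \<noteq> 0"
    \<comment> \<open>At this point the affine polynomial A + 2 s B has the value -1.\<close>
    with assms(2)[of "- (A + 1) / (2 * B)"] True show False by (simp add: field_simps)
  qed
  thus ?thesis using True by simp
next
  case False
  hence "D > 0" using assms(1) by simp
  \<comment> \<open>The minimiser of the quadratic polynomial.\<close>
  with assms(2)[of "- B / D"] show ?thesis
    by (simp add: field_simps power2_eq_square)
qed

text \<open>\<open>C\<close> stands for the embedding constant; the assumption on it also supplies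
  the continuous representatives behind \<open>pt\<close>. The data of the right-hand side stay
  outside, since the Galerkin argument is run for general functionals.\<close>

locale parabolic_setting =
  fixes \<iota> :: "'v::{real_inner, banach, second_countable_topology} \<Rightarrow>
              'h::{real_inner, banach, second_countable_topology}"
    and a :: "'v \<Rightarrow> 'v \<Rightarrow> real" and T C :: real
  assumes embedding: "gelfand_embedding \<iota>" and coercive: "coercive_form a"
    and T_pos: "T > 0" and embed: "embedding_constant \<iota> a T C"
begin

lemma \<iota>: "bounded_linear \<iota>"
  using embedding by (simp add: gelfand_embedding_def)

lemma a_bilinear: "bounded_bilinear a"
  using coercive by (simp add: coercive_form_def)

lemma a_commute: "a u v = a v u"
  using coercive by (simp add: coercive_form_def)

lemmas W_closed = W_add_scaleR[OF \<iota>]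

lemma zero_W: "(\<lambda>t. 0) \<in> W \<iota> T"
proof -
  have "(\<lambda>t. 0 :: 'v) \<in> L2 T" "(\<lambda>t. 0 :: 'v \<Rightarrow>\<^sub>L real) \<in> L2 T" by (simp_all add: continuous_imp_L2)
  moreover have "has_weak_derivative \<iota> T (\<lambda>t. 0) (\<lambda>t. 0)"
    using linear_0[OF bounded_linear.linear[OF bounded_linear_dual_embed[OF \<iota>]]]
    by (simp add: has_weak_derivative_def)
  ultimately show ?thesis unfolding W_def by blast
qed

section \<open>Point values in H\<close>

lemma pt_rep: "v \<in> W \<iota> T \<Longrightarrow> is_continuous_rep \<iota> T v (pt \<iota> T v)"
  using embed by (simp add: embedding_constant_def)

text \<open>Makes the choice in \<open>pt\<close> harmless: linearity and invariance of point values
  follow by exhibiting a continuous representative.\<close>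

lemma pt_eqI:
  assumes "v \<in> W \<iota> T" "is_continuous_rep \<iota> T v u" "t \<in> {0..T}"
  shows "pt \<iota> T v t = u t"
proof (rule continuous_AE_eq_imp_eq[OF T_pos _ _ _ assms(3)])
  show "continuous_on {0..T} (pt \<iota> T v)" "continuous_on {0..T} u"
    using pt_rep[OF assms(1)] assms(2) by (simp_all add: is_continuous_rep_def)
  have "AE t in time T. pt \<iota> T v t = \<iota> (v t)" "AE t in time T. u t = \<iota> (v t)"
    using pt_rep[OF assms(1)] assms(2) by (simp_all add: is_continuous_rep_def ae_eq_def)
  thus "AE t in time T. pt \<iota> T v t = u t" by eventually_elim simp
qed

lemma pt_add_scaleR:
  assumes "u \<in> W \<iota> T" "v \<in> W \<iota> T" "t \<in> {0..T}"
  shows "pt \<iota> T (\<lambda>t. u t + c *\<^sub>R v t) t = pt \<iota> T u t + c *\<^sub>R pt \<iota> T v t"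
proof (rule pt_eqI[OF W_closed[OF assms(1,2)] _ assms(3)])
  have *: "continuous_on {0..T} (pt \<iota> T u)" "continuous_on {0..T} (pt \<iota> T v)"
    "AE t in time T. pt \<iota> T u t = \<iota> (u t)" "AE t in time T. pt \<iota> T v t = \<iota> (v t)"
    using assms(1,2)[THEN pt_rep] by (simp_all add: is_continuous_rep_def ae_eq_def)
  from *(3,4) have "AE t in time T. pt \<iota> T u t + c *\<^sub>R pt \<iota> T v t = \<iota> (u t + c *\<^sub>R v t)"
    by eventually_elim (simp add: linear_add linear_scale bounded_linear.linear[OF \<iota>])
  thus "is_continuous_rep \<iota> T (\<lambda>t. u t + c *\<^sub>R v t) (\<lambda>t. pt \<iota> T u t + c *\<^sub>R pt \<iota> T v t)"
    unfolding is_continuous_rep_def ae_eq_def by (intro conjI continuous_intros *)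
qed

lemma pt_cong:
  assumes "u \<in> W \<iota> T" "v \<in> W \<iota> T" "ae_eq T u v" "t \<in> {0..T}"
  shows "pt \<iota> T u t = pt \<iota> T v t"
proof (rule pt_eqI[OF assms(1) _ assms(4)])
  have *: "continuous_on {0..T} (pt \<iota> T v)" "AE t in time T. pt \<iota> T v t = \<iota> (v t)"
    using pt_rep[OF assms(2)] by (simp_all add: is_continuous_rep_def ae_eq_def)
  from *(2) assms(3) have "AE t in time T. pt \<iota> T v t = \<iota> (u t)"
    unfolding ae_eq_def by eventually_elim simp
  thus "is_continuous_rep \<iota> T u (pt \<iota> T v)"
    using * by (simp add: is_continuous_rep_def ae_eq_def)
qed

text \<open>A real \<open>SUP\<close> dominates its members only when they are bounded above;
  continuity on the compact interval provides this.\<close>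

lemma pt_norm_le:
  assumes "v \<in> W \<iota> T" "t \<in> {0..T}"
  shows "norm (pt \<iota> T v t) \<le> C * W_norm \<iota> a T v"
proof -
  have "continuous_on {0..T} (\<lambda>t. norm (pt \<iota> T v t))"
    using pt_rep[OF assms(1)] by (intro continuous_intros) (simp add: is_continuous_rep_def)
  hence "bdd_above ((\<lambda>t. norm (pt \<iota> T v t)) ` {0..T})"
    by (intro bounded_imp_bdd_above compact_imp_bounded compact_continuous_image) auto
  hence "norm (pt \<iota> T v t) \<le> (SUP t\<in>{0..T}. norm (pt \<iota> T v t))"
    by (rule cSUP_upper[OF assms(2)])
  thus ?thesis using embed assms(1) by (auto simp: embedding_constant_def)
qed

section \<open>The inner product of W(0,T)\<close>

lemma W_inner_commute: "W_inner \<iota> a T u v = W_inner \<iota> a T v u"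
  by (simp add: W_inner_def dual_inner_def a_commute)

lemma W_inner_add_scaleR_right:
  assumes "x \<in> W \<iota> T" "u \<in> W \<iota> T" "v \<in> W \<iota> T"
  shows "W_inner \<iota> a T x (\<lambda>t. u t + c *\<^sub>R v t) = W_inner \<iota> a T x u + c * W_inner \<iota> a T x v"
proof -
  note uv = W_closed[OF assms(2,3), of c]
  show ?thesis
    unfolding W_inner_def
      integral_bilinear_L2_add_scaleR[OF bounded_bilinear_dual_inner[OF coercive] weak_deriv(1)[OF assms(1)]
        weak_deriv(1)[OF assms(2)] weak_deriv(1)[OF assms(3)] weak_deriv(1)[OF uv]
        weak_deriv_add_scaleR[OF \<iota> assms(2,3)]]
      integral_bilinear_L2_add_scaleR[OF a_bilinear W_L2[OF assms(1)]
        W_L2[OF assms(2)] W_L2[OF assms(3)] W_L2[OF uv] AE_I2[OF refl]]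
    by (simp add: algebra_simps)
qed

lemma W_inner_cong_right:
  assumes "x \<in> W \<iota> T" "u \<in> W \<iota> T" "v \<in> W \<iota> T" "ae_eq T u v"
  shows "W_inner \<iota> a T x u = W_inner \<iota> a T x v"
proof -
  have "AE t in time T. u t = v t" using assms(4) by (simp add: ae_eq_def)
  from integral_bilinear_L2_cong_AE[OF a_bilinear W_L2[OF assms(1)] W_L2[OF assms(3)] W_L2[OF assms(2)] this]
    integral_bilinear_L2_cong_AE[OF bounded_bilinear_dual_inner[OF coercive] weak_deriv(1)[OF assms(1)]
      weak_deriv(1)[OF assms(3)] weak_deriv(1)[OF assms(2)] weak_deriv_cong_AE[OF \<iota> assms(2-4)]]
  show ?thesis by (simp add: W_inner_def)
qed

lemma dual_inner_nonneg: "0 \<le> dual_inner a \<phi> \<phi>"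
  unfolding dual_inner_def by (rule coercive_form_nonneg[OF coercive])

lemma W_inner_nonneg: "0 \<le> W_inner \<iota> a T v v"
  unfolding W_inner_def
  by (intro add_nonneg_nonneg Bochner_Integration.integral_nonneg dual_inner_nonneg
      coercive_form_nonneg[OF coercive])

lemma W_norm_nonneg: "0 \<le> W_norm \<iota> a T v"
  by (simp add: W_norm_def W_inner_nonneg)

lemma W_norm_power2: "(W_norm \<iota> a T v)\<^sup>2 = W_inner \<iota> a T v v"
  by (simp add: W_norm_def W_inner_nonneg)

text \<open>Both integrals are nonnegative, so the one of a(v, v) vanishes, its integrand is null,
  and coercivity of \<open>a\<close> applies pointwise.\<close>

lemma W_inner_self_eq_0:
  assumes v: "v \<in> W \<iota> T" and "W_inner \<iota> a T v v = 0"
  shows "ae_eq T v (\<lambda>t. 0)"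
proof -
  have "0 \<le> (\<integral>t. dual_inner a (weak_deriv \<iota> T v t) (weak_deriv \<iota> T v t) \<partial>time T)"
    "0 \<le> (\<integral>t. a (v t) (v t) \<partial>time T)"
    by (intro Bochner_Integration.integral_nonneg dual_inner_nonneg coercive_form_nonneg[OF coercive])+
  hence "(\<integral>t. a (v t) (v t) \<partial>time T) = 0" using assms(2) by (simp add: W_inner_def)
  hence "AE t in time T. a (v t) (v t) = 0"
    using integrable_bilinear_L2[OF a_bilinear W_L2[OF v] W_L2[OF v]]
    by (subst (asm) integral_nonneg_eq_0_iff_AE) (simp_all add: coercive_form_nonneg[OF coercive])
  thus ?thesis
    unfolding ae_eq_def by eventually_elim (rule coercive_form_zero[OF coercive])
qed

text \<open>Cauchy-Schwarz from the discriminant of s \<mapsto> (u + s v, u + s v). On functions the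
  form is only semidefinite, null functions having norm 0, hence the route through a nonnegative
  polynomial.\<close>

lemma W_inner_le:
  assumes "u \<in> W \<iota> T" "v \<in> W \<iota> T"
  shows "W_inner \<iota> a T u v \<le> W_norm \<iota> a T u * W_norm \<iota> a T v"
proof -
  let ?I = "W_inner \<iota> a T"
  have "0 \<le> ?I u u + 2 * s * ?I u v + s\<^sup>2 * ?I v v" for s
  proof -
    let ?w = "\<lambda>t. u t + s *\<^sub>R v t"
    note w = W_closed[OF assms, of s]
    have "0 \<le> ?I ?w ?w" by (rule W_inner_nonneg)
    also have "?I ?w ?w = ?I ?w u + s * ?I ?w v"
      by (rule W_inner_add_scaleR_right[OF w assms])
    also have "?I ?w u = ?I u u + s * ?I u v"
      unfolding W_inner_commute[of ?w u] by (rule W_inner_add_scaleR_right[OF assms(1) assms])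
    also have "?I ?w v = ?I u v + s * ?I v v"
      unfolding W_inner_commute[of ?w v] W_inner_commute[of u v]
      by (rule W_inner_add_scaleR_right[OF assms(2) assms])
    also have "?I u u + s * ?I u v + s * (?I u v + s * ?I v v) = ?I u u + 2 * s * ?I u v + s\<^sup>2 * ?I v v"
      by (simp add: power2_eq_square algebra_simps)
    finally show ?thesis .
  qed
  hence "(?I u v)\<^sup>2 \<le> ?I u u * ?I v v" by (rule nonneg_quadratic_discriminant[OF W_inner_nonneg])
  hence "(?I u v)\<^sup>2 \<le> (W_norm \<iota> a T u * W_norm \<iota> a T v)\<^sup>2"
    by (simp add: power_mult_distrib W_norm_power2)
  thus ?thesis by (rule power2_le_imp_le) (simp add: W_norm_nonneg)
qed

section \<open>The form b and the functional l\<close>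

lemma b_form_eq: "b_form \<iota> a T u v = W_inner \<iota> a T u v + inner (pt \<iota> T u T) (pt \<iota> T v T)"
  by (simp add: b_form_def W_inner_def)

lemma b_form_commute: "b_form \<iota> a T u v = b_form \<iota> a T v u"
  by (simp add: b_form_eq W_inner_commute[of u v] inner_commute)

lemma b_form_add_scaleR_right:
  assumes "x \<in> W \<iota> T" "u \<in> W \<iota> T" "v \<in> W \<iota> T"
  shows "b_form \<iota> a T x (\<lambda>t. u t + c *\<^sub>R v t) = b_form \<iota> a T x u + c * b_form \<iota> a T x v"
  using assms T_pos
  by (simp add: b_form_eq W_inner_add_scaleR_right pt_add_scaleR inner_add_right algebra_simps)

lemma b_form_add_scaleR_left:
  assumes "x \<in> W \<iota> T" "u \<in> W \<iota> T" "v \<in> W \<iota> T"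
  shows "b_form \<iota> a T (\<lambda>t. u t + c *\<^sub>R v t) x = b_form \<iota> a T u x + c * b_form \<iota> a T v x"
  using b_form_add_scaleR_right[OF assms] by (simp add: b_form_commute[of _ x])

lemma b_form_cong_right:
  assumes "x \<in> W \<iota> T" "u \<in> W \<iota> T" "v \<in> W \<iota> T" "ae_eq T u v"
  shows "b_form \<iota> a T x u = b_form \<iota> a T x v"
  using assms T_pos W_inner_cong_right[OF assms] pt_cong[OF assms(2-4), of T]
  by (simp add: b_form_eq)

lemma W_norm_power2_le_b_form: "(W_norm \<iota> a T v)\<^sup>2 \<le> b_form \<iota> a T v v"
  by (simp add: b_form_eq W_norm_power2)

lemma b_form_self_eq_0:
  assumes "v \<in> W \<iota> T" "b_form \<iota> a T v v = 0"
  shows "ae_eq T v (\<lambda>t. 0)"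
  using W_norm_power2_le_b_form[of v] assms W_inner_nonneg[of v]
  by (intro W_inner_self_eq_0) (simp_all add: W_norm_power2)

lemma b_form_le:
  assumes "u \<in> W \<iota> T" "v \<in> W \<iota> T"
  shows "b_form \<iota> a T u v \<le> (1 + C\<^sup>2) * (W_norm \<iota> a T u * W_norm \<iota> a T v)"
proof -
  have *: "norm (pt \<iota> T u T) \<le> C * W_norm \<iota> a T u" "norm (pt \<iota> T v T) \<le> C * W_norm \<iota> a T v"
    using pt_norm_le[OF assms(1), of T] pt_norm_le[OF assms(2), of T] T_pos by auto
  have "inner (pt \<iota> T u T) (pt \<iota> T v T) \<le> norm (pt \<iota> T u T) * norm (pt \<iota> T v T)"
    by (rule norm_cauchy_schwarz)
  \<comment> \<open>The sign of \<open>C\<close> is not given; monotonicity of the product uses 0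
    \<le> C |u|, which follows from the bound on the norm of the point value.\<close>
  also have "\<dots> \<le> (C * W_norm \<iota> a T u) * (C * W_norm \<iota> a T v)"
    using order_trans[OF norm_ge_zero *(1)] by (intro mult_mono * ) auto
  finally show ?thesis
    using W_inner_le[OF assms] by (simp add: b_form_eq power2_eq_square algebra_simps)
qed

lemma l_form_add_scaleR:
  assumes f: "f \<in> L2 T" and "u \<in> W \<iota> T" "v \<in> W \<iota> T"
  shows "l_form \<iota> a T f y0 (\<lambda>t. u t + c *\<^sub>R v t) = l_form \<iota> a T f y0 u + c * l_form \<iota> a T f y0 v"
proof -
  note uv = W_closed[OF assms(2,3), of c]
  have "0 \<in> {0..T}" using T_pos by simp
  show ?thesis
    unfolding l_form_def pt_add_scaleR[OF assms(2,3) \<open>0 \<in> {0..T}\<close>]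
      integral_bilinear_L2_add_scaleR[OF bounded_bilinear_dual_inner[OF coercive] f
        weak_deriv(1)[OF assms(2)] weak_deriv(1)[OF assms(3)] weak_deriv(1)[OF uv]
        weak_deriv_add_scaleR[OF \<iota> assms(2,3)]]
      integral_bilinear_L2_add_scaleR[OF bounded_bilinear_blinfun_apply f
        W_L2[OF assms(2)] W_L2[OF assms(3)] W_L2[OF uv] AE_I2[OF refl]]
    by (simp add: algebra_simps inner_add_right)
qed

lemma l_form_cong:
  assumes f: "f \<in> L2 T" and "u \<in> W \<iota> T" "v \<in> W \<iota> T" "ae_eq T u v"
  shows "l_form \<iota> a T f y0 u = l_form \<iota> a T f y0 v"
proof -
  have "AE t in time T. u t = v t" using assms(4) by (simp add: ae_eq_def)
  from integral_bilinear_L2_cong_AE[OF bounded_bilinear_blinfun_apply f W_L2[OF assms(3)] W_L2[OF assms(2)] this]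
    integral_bilinear_L2_cong_AE[OF bounded_bilinear_dual_inner[OF coercive] f
      weak_deriv(1)[OF assms(3)] weak_deriv(1)[OF assms(2)] weak_deriv_cong_AE[OF \<iota> assms(2-4)]]
    pt_cong[OF assms(2-4), of 0] T_pos
  show ?thesis by (simp add: l_form_def)
qed

text \<open>The linear span taken among functions, before any identification almost everywhere. It
  is generated by the operation u + c v, so each linearity lemma is exactly one induction
  step.\<close>

inductive_set lspan :: "(real \<Rightarrow> 'v) set \<Rightarrow> (real \<Rightarrow> 'v) set" for B where
  zero: "(\<lambda>t. 0) \<in> lspan B"
| base: "b \<in> B \<Longrightarrow> b \<in> lspan B"
| add_scaleR: "u \<in> lspan B \<Longrightarrow> v \<in> lspan B \<Longrightarrow> (\<lambda>t. u t + c *\<^sub>R v t) \<in> lspan B"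

lemma lspan_mono:
  assumes "B \<subseteq> B'" "u \<in> lspan B"
  shows "u \<in> lspan B'"
  using assms(2) by induction (use assms(1) in \<open>auto intro: lspan.intros\<close>)

lemma lspan_subset:
  assumes "B \<subseteq> S" "(\<lambda>t. 0) \<in> S" "\<And>u v c. u \<in> S \<Longrightarrow> v \<in> S \<Longrightarrow> (\<lambda>t. u t + c *\<^sub>R v t) \<in> S"
  shows "lspan B \<subseteq> S"
proof
  fix u assume "u \<in> lspan B"
  thus "u \<in> S" by induction (use assms in auto)
qed

lemma lspan_sum:
  assumes "finite A" "A \<subseteq> B"
  shows "(\<lambda>t. \<Sum>b\<in>A. c b *\<^sub>R b t) \<in> lspan B"
  using assms
proof (induction rule: finite_induct)
  case (insert x F)
  have "(\<lambda>t. (\<Sum>b\<in>F. c b *\<^sub>R b t) + c x *\<^sub>R x t) \<in> lspan B"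
    by (intro lspan.add_scaleR lspan.base insert.IH) (use insert.prems in auto)
  thus ?case using insert.hyps by (simp add: add.commute)
qed (simp add: lspan.zero)

lemma lspan_W: "B \<subseteq> W \<iota> T \<Longrightarrow> lspan B \<subseteq> W \<iota> T"
  by (rule lspan_subset[OF _ zero_W W_closed])

section \<open>Linear functionals on W(0,T) and the Galerkin problem on a span\<close>

lemma b_form_ae_zero:
  assumes "u \<in> W \<iota> T" "e \<in> W \<iota> T" "ae_eq T e (\<lambda>t. 0)"
  shows "b_form \<iota> a T u e = 0"
  \<comment> \<open>Additivity at 0 + 1 0 reads b(u, 0) = b(u, 0) + b(u, 0), hence b(u, 0) =
    0.\<close>
  using b_form_cong_right[OF assms(1,2) zero_W assms(3)]
    b_form_add_scaleR_right[OF assms(1) zero_W zero_W, of 1] by simp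

text \<open>Common abstraction of \<open>l\<close> and of b(u, -). The induction over generators
  needs both as right-hand sides. The second clause makes the functional descend to classes modulo
  null functions.\<close>

definition W_functional :: "((real \<Rightarrow> 'v) \<Rightarrow> real) \<Rightarrow> bool" where
  "W_functional L \<longleftrightarrow>
     (\<forall>u\<in>W \<iota> T. \<forall>v\<in>W \<iota> T. \<forall>c. L (\<lambda>t. u t + c *\<^sub>R v t) = L u + c * L v) \<and>
     (\<forall>u\<in>W \<iota> T. ae_eq T u (\<lambda>t. 0) \<longrightarrow> L u = 0)"

lemma W_functional_add_scaleR:
  "W_functional L \<Longrightarrow> u \<in> W \<iota> T \<Longrightarrow> v \<in> W \<iota> T \<Longrightarrow> L (\<lambda>t. u t + c *\<^sub>R v t) = L u + c * L v"
  by (simp add: W_functional_def)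

lemma W_functional_ae_zero: "W_functional L \<Longrightarrow> u \<in> W \<iota> T \<Longrightarrow> ae_eq T u (\<lambda>t. 0) \<Longrightarrow> L u = 0"
  by (simp add: W_functional_def)

lemma W_functional_b_form: "u \<in> W \<iota> T \<Longrightarrow> W_functional (b_form \<iota> a T u)"
  by (simp add: W_functional_def b_form_add_scaleR_right b_form_ae_zero)

lemma W_functional_l_form:
  assumes "f \<in> L2 T"
  shows "W_functional (l_form \<iota> a T f y0)"
proof -
  have "l_form \<iota> a T f y0 u = 0" if "u \<in> W \<iota> T" "ae_eq T u (\<lambda>t. 0)" for u
    using l_form_cong[OF assms that(1) zero_W that(2)]
      l_form_add_scaleR[OF assms zero_W zero_W, of y0 1] by simp
  thus ?thesis by (simp add: W_functional_def l_form_add_scaleR[OF assms])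
qed

lemma W_functional_eq_on_lspan:
  assumes "W_functional K" "W_functional L" "B \<subseteq> W \<iota> T" "\<And>w. w \<in> B \<Longrightarrow> K w = L w" "w \<in> lspan B"
  shows "K w = L w"
  using assms(5)
proof induction
  case zero
  show ?case using assms(1,2)[THEN W_functional_ae_zero, OF zero_W] by (simp add: ae_eq_def)
next
  case (add_scaleR p q c)
  hence "p \<in> W \<iota> T" "q \<in> W \<iota> T" using lspan_W[OF assms(3)] by auto
  thus ?case using add_scaleR.IH assms(1,2)[THEN W_functional_add_scaleR] by simp
qed (rule assms(4))

text \<open>One Gram-Schmidt step per generator. A new generator \<open>x\<close> may be dependent on the old ones modulo
  null functions; then its residual \<open>e\<close> is almost everywhere zero, and the old solution persists.\<close>

lemma galerkin_on_lspan:
  assumes "finite B" "B \<subseteq> W \<iota> T" "W_functional L"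
  shows "\<exists>u\<in>lspan B. \<forall>w\<in>lspan B. b_form \<iota> a T u w = L w"
  using assms
proof (induction B arbitrary: L rule: finite_induct)
  case empty
  show ?case
  proof (intro bexI ballI)
    fix w :: "real \<Rightarrow> 'v" assume "w \<in> lspan {}"
    thus "b_form \<iota> a T (\<lambda>t. 0) w = L w"
      by (rule W_functional_eq_on_lspan[OF W_functional_b_form[OF zero_W] empty(2,1), rotated]) simp
  qed (rule lspan.zero)
next
  case (insert x B)
  hence x: "x \<in> W \<iota> T" and B: "B \<subseteq> W \<iota> T" by auto
  let ?b = "b_form \<iota> a T"
  let ?M = "lspan (insert x B)"
  have M: "?M \<subseteq> W \<iota> T" by (rule lspan_W[OF insert.prems(1)])
  have BM: "lspan B \<subseteq> ?M" using lspan_mono[of B "insert x B"] by blast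
  obtain u where u: "u \<in> lspan B" "\<And>w. w \<in> lspan B \<Longrightarrow> ?b u w = L w"
    using insert.IH[OF B insert.prems(2)] by blast
  \<comment> \<open>The induction hypothesis with right-hand side b(x, -): \<open>p\<close> is a
    b-orthogonal projection of \<open>x\<close> onto the old span, and \<open>e\<close> below is the
    residual.\<close>
  obtain p where p: "p \<in> lspan B" "\<And>w. w \<in> lspan B \<Longrightarrow> ?b p w = ?b x w"
    using insert.IH[OF B W_functional_b_form[OF x]] by blast
  have uW: "u \<in> W \<iota> T" and pW: "p \<in> W \<iota> T" using u p lspan_W[OF B] by auto
  define e where "e = (\<lambda>t. x t + (- 1) *\<^sub>R p t)"
  have eM: "e \<in> ?M"
    unfolding e_def by (rule lspan.add_scaleR[OF lspan.base]) (use p(1) BM in auto)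
  hence eW: "e \<in> W \<iota> T" using M by blast
  have be: "?b e w = ?b x w - ?b p w" if "w \<in> W \<iota> T" for w
    unfolding e_def b_form_add_scaleR_left[OF that x pW] by simp
  have be0: "?b e w = 0" if "w \<in> lspan B" for w
    using be[of w] p(2)[OF that] that lspan_W[OF B] by auto
  \<comment> \<open>\<open>e\<close> is b-orthogonal to \<open>p\<close>, which lies in the old
    span.\<close>
  have ee: "?b e e = ?b e x"
    using b_form_add_scaleR_right[OF eW x pW, of "- 1"] be0[OF p(1)] by (simp add: e_def)
  have Le: "L e = L x - L p"
    unfolding e_def W_functional_add_scaleR[OF insert.prems(2) x pW] by simp
  have ue: "?b u e = 0" using be0[OF u(1)] by (simp add: b_form_commute[of u e])
  \<comment> \<open>Split x = p + e: the part b(u, e) vanishes, and \<open>u\<close> solves the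
    problem against \<open>p\<close>.\<close>
  have ux: "?b u x = L p"
    using b_form_add_scaleR_right[OF uW x pW, of "- 1"] ue u(2)[OF p(1)] by (simp add: e_def)
  show ?case
  proof (cases "?b e e = 0")
    case True
    hence "L e = 0" using W_functional_ae_zero[OF insert.prems(2) eW b_form_self_eq_0[OF eW]] by blast
    hence "?b u w = L w" if "w \<in> insert x B" for w
      using that u(2)[of w] ux Le by (auto intro: lspan.base)
    hence "\<forall>w\<in>?M. ?b u w = L w"
      using W_functional_eq_on_lspan[OF W_functional_b_form[OF uW] insert.prems(2,1)] by blast
    thus ?thesis using u(1) BM by blast
  next
    case False
    \<comment> \<open>Corrects the defect of \<open>u\<close> at the new generator: b(u + s e, x) =
      L p + s b(e, e) = L p + L e = L x, while b(e, -) vanishes on the old span.\<close>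
    define s where "s = L e / ?b e e"
    let ?u = "\<lambda>t. u t + s *\<^sub>R e t"
    have uM: "?u \<in> ?M" using u(1) BM eM by (intro lspan.add_scaleR) auto
    have "?b ?u w = L w" if "w \<in> insert x B" for w
    proof (cases "w = x")
      case True
      thus ?thesis using b_form_add_scaleR_left[OF x uW eW, of s] ux Le False
        by (simp add: s_def ee[symmetric])
    next
      case False
      hence "w \<in> B" "w \<in> W \<iota> T" using that B by auto
      thus ?thesis using b_form_add_scaleR_left[of w u e s] uW eW u(2)[of w] be0[of w]
        by (simp add: lspan.base)
    qed
    hence "\<forall>w\<in>?M. ?b ?u w = L w"
      using W_functional_eq_on_lspan[OF W_functional_b_form[OF W_closed[OF uW eW]] insert.prems(2,1)] by blast
    thus ?thesis using uM by blast
  qed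
qed

end

section \<open>Existence, uniqueness and quasi-optimality for the given subspace\<close>

theorem theorem3p1:
  fixes \<iota> :: "'v::{real_inner, banach, second_countable_topology} \<Rightarrow>
              'h::{real_inner, banach, second_countable_topology}"
    and a :: "'v \<Rightarrow> 'v \<Rightarrow> real"
    and T C\<^sub>e :: real
    and f :: "real \<Rightarrow> 'v \<Rightarrow>\<^sub>L real"
    and y\<^sub>0 :: 'h
    and y :: "real \<Rightarrow> 'v"
    and W\<^sub>d :: "(real \<Rightarrow> 'v) set"
  assumes "gelfand_embedding \<iota>"
    and "coercive_form a"
    and "T > 0"
    and "embedding_constant \<iota> a T C\<^sub>e"
    and "f \<in> L2 T"
    and "y \<in> W \<iota> T"
    and "\<forall>w\<in>W \<iota> T. b_form \<iota> a T y w = l_form \<iota> a T f y\<^sub>0 w"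
    and "finite_dim_subspace \<iota> T W\<^sub>d"
  shows "(\<exists>y\<^sub>d\<in>W\<^sub>d. (\<forall>w\<^sub>d\<in>W\<^sub>d. b_form \<iota> a T y\<^sub>d w\<^sub>d = l_form \<iota> a T f y\<^sub>0 w\<^sub>d) \<and>
            (\<forall>z\<in>W\<^sub>d. (\<forall>w\<^sub>d\<in>W\<^sub>d. b_form \<iota> a T z w\<^sub>d = l_form \<iota> a T f y\<^sub>0 w\<^sub>d) \<longrightarrow> ae_eq T z y\<^sub>d)) \<and>
         (\<forall>y\<^sub>d\<in>W\<^sub>d. (\<forall>w\<^sub>d\<in>W\<^sub>d. b_form \<iota> a T y\<^sub>d w\<^sub>d = l_form \<iota> a T f y\<^sub>0 w\<^sub>d) \<longrightarrow>
            W_norm \<iota> a T (\<lambda>t. y t - y\<^sub>d t)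
              \<le> (1 + C\<^sub>e\<^sup>2) * (INF w\<^sub>d\<in>W\<^sub>d. W_norm \<iota> a T (\<lambda>t. y t - w\<^sub>d t)))"
proof -
  interpret parabolic_setting \<iota> a T C\<^sub>e
    using assms(1-4) by unfold_locales
  let ?b = "b_form \<iota> a T" and ?l = "l_form \<iota> a T f y\<^sub>0" and ?N = "W_norm \<iota> a T"
  note fd = assms(8)[unfolded finite_dim_subspace_def]
  have WdW: "W\<^sub>d \<subseteq> W \<iota> T" and zero: "(\<lambda>t. 0) \<in> W\<^sub>d"
    using fd by simp_all
  have add: "(\<lambda>t. u t + v t) \<in> W\<^sub>d" and scale: "(\<lambda>t. c *\<^sub>R u t) \<in> W\<^sub>d"
    if "u \<in> W\<^sub>d" "v \<in> W\<^sub>d" for u v c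
    using fd that by simp_all
  obtain B where B: "finite B" "B \<subseteq> W\<^sub>d"
      "\<forall>v\<in>W\<^sub>d. \<exists>c. ae_eq T v (\<lambda>t. \<Sum>b\<in>B. c b *\<^sub>R b t)"
    using fd by (elim conjE exE)
  \<comment> \<open>\<open>scale\<close> inherits two membership premises from the joint
    \<open>if\<close>, so the membership of \<open>v\<close> is supplied twice.\<close>
  have Wd_closed: "(\<lambda>t. u t + c *\<^sub>R v t) \<in> W\<^sub>d" if "u \<in> W\<^sub>d" "v \<in> W\<^sub>d" for u v c
    using add[OF that(1) scale[OF that(2,2)]] .
  have Wd_diff: "(\<lambda>t. u t - v t) \<in> W\<^sub>d" if "u \<in> W\<^sub>d" "v \<in> W\<^sub>d" for u v
    using Wd_closed[OF that, of "- 1"] by simp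
  have W_diff: "(\<lambda>t. u t - v t) \<in> W \<iota> T" if "u \<in> W \<iota> T" "v \<in> W \<iota> T" for u v
    using W_closed[OF that, of "- 1"] by simp
  have b_diff: "?b (\<lambda>t. u t - v t) w = ?b u w - ?b v w"
    if "w \<in> W \<iota> T" "u \<in> W \<iota> T" "v \<in> W \<iota> T" for u v w
    using b_form_add_scaleR_left[OF that, of "- 1"] by simp
  have spanWd: "lspan B \<subseteq> W\<^sub>d" by (rule lspan_subset[OF B(2) zero Wd_closed])
  obtain yd where yd: "yd \<in> lspan B" "\<forall>w\<in>lspan B. ?b yd w = ?l w"
    using galerkin_on_lspan[OF B(1) subset_trans[OF B(2) WdW] W_functional_l_form[OF assms(5)]] by (rule bexE)
  have ydW: "yd \<in> W\<^sub>d" using yd(1) spanWd by blast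
  have yd_solves: "?b yd w = ?l w" if "w \<in> W\<^sub>d" for w
  proof -
    \<comment> \<open>\<open>lspan B\<close> may be smaller than the subspace as a set of functions.
      Each \<open>w\<close> agrees almost everywhere with an element of the span, and both forms are
      invariant under this change.\<close>
    obtain c where c: "ae_eq T w (\<lambda>t. \<Sum>b\<in>B. c b *\<^sub>R b t)" using bspec[OF B(3) \<open>w \<in> W\<^sub>d\<close>] by (rule exE)
    let ?w = "\<lambda>t. \<Sum>b\<in>B. c b *\<^sub>R b t"
    have w': "?w \<in> lspan B" by (rule lspan_sum[OF B(1) subset_refl])
    have W: "yd \<in> W \<iota> T" "w \<in> W \<iota> T" "?w \<in> W \<iota> T"
      using ydW that w' spanWd WdW by auto
    show ?thesis
      using b_form_cong_right[OF W c] l_form_cong[OF assms(5) W(2,3) c] bspec[OF yd(2) w'] by simp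
  qed
  have unique: "ae_eq T z yd" if z: "z \<in> W\<^sub>d" "\<forall>w\<in>W\<^sub>d. ?b z w = ?l w" for z
  proof -
    let ?d = "\<lambda>t. z t - yd t"
    have d: "?d \<in> W\<^sub>d" by (rule Wd_diff[OF z(1) ydW])
    \<comment> \<open>The difference of two solutions is itself an admissible test function.\<close>
    have "?b ?d ?d = ?b z ?d - ?b yd ?d" using d z(1) ydW WdW by (intro b_diff) auto
    also have "\<dots> = 0" using z(2) d yd_solves[OF d] by simp
    finally have "ae_eq T ?d (\<lambda>t. 0)" using d WdW by (intro b_form_self_eq_0) auto
    thus ?thesis by (simp add: ae_eq_def)
  qed
  have cea: "?N (\<lambda>t. y t - z t) \<le> (1 + C\<^sub>e\<^sup>2) * (INF w\<in>W\<^sub>d. ?N (\<lambda>t. y t - w t))"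
    if z: "z \<in> W\<^sub>d" "\<forall>w\<in>W\<^sub>d. ?b z w = ?l w" for z
  proof -
    let ?e = "\<lambda>t. y t - z t"
    have zW: "z \<in> W \<iota> T" using z(1) WdW by blast
    have eW: "?e \<in> W \<iota> T" by (rule W_diff[OF assms(6) zW])
    have orth: "?b ?e w = 0" if "w \<in> W\<^sub>d" for w
      using b_diff[OF _ assms(6) zW, of w] that z(2) assms(7) WdW by auto
    \<comment> \<open>Dividing by the positive constant first turns the claim into a lower bound for
      the infimum, to be checked for each \<open>w\<close> separately.\<close>
    have "?N ?e / (1 + C\<^sub>e\<^sup>2) \<le> (INF w\<in>W\<^sub>d. ?N (\<lambda>t. y t - w t))"
    proof (rule cINF_greatest)
      show "W\<^sub>d \<noteq> {}" using zero by blast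
      fix w assume w: "w \<in> W\<^sub>d"
      let ?d = "\<lambda>t. y t - w t"
      have dW: "?d \<in> W \<iota> T" using w WdW by (intro W_diff assms(6)) auto
      have wz: "(\<lambda>t. w t - z t) \<in> W\<^sub>d" by (rule Wd_diff[OF w z(1)])
      have "(?N ?e)\<^sup>2 \<le> ?b ?e ?e" by (rule W_norm_power2_le_b_form)
      \<comment> \<open>Here y - z = (y - w) + (w - z), and w - z lies in the subspace, where b(e,
        -) vanishes.\<close>
      also have "?b ?e ?e = ?b ?e ?d"
        using b_form_add_scaleR_right[OF eW dW, of "\<lambda>t. w t - z t" 1] orth[OF wz] wz WdW by auto
      also have "\<dots> \<le> (1 + C\<^sub>e\<^sup>2) * (?N ?e * ?N ?d)" by (rule b_form_le[OF eW dW])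
      finally have "?N ?e * ?N ?e \<le> ((1 + C\<^sub>e\<^sup>2) * ?N ?d) * ?N ?e"
        by (simp add: power2_eq_square mult_ac)
      \<comment> \<open>Cancelling the norm of the error requires it to be nonzero; for a zero error
        this nonnegative bound suffices.\<close>
      moreover have "0 \<le> (1 + C\<^sub>e\<^sup>2) * ?N ?d" by (simp add: W_norm_nonneg)
      ultimately have "?N ?e \<le> (1 + C\<^sub>e\<^sup>2) * ?N ?d"
        using W_norm_nonneg[of ?e] by (cases "?N ?e = 0") auto
      thus "?N ?e / (1 + C\<^sub>e\<^sup>2) \<le> ?N ?d"
        by (subst pos_divide_le_eq) (simp_all add: mult.commute add_pos_nonneg)
    qed
    thus ?thesis
      by (subst (asm) pos_divide_le_eq) (simp_all add: mult.commute add_pos_nonneg)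
  qed
  show ?thesis using ydW yd_solves unique cea by blast
qed

end
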